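(* Let $\alpha,\beta\in\mathbb{R}$ and let $(u,v)\in C([0,\infty),L^2(\mathbb{R}))$ be any strong solution (in the sense defined in the context) of the Cauchy problem $$i(u_t+u_x)=N_1(u,v),\qquad i(v_t-v_x)=N_2(u,v),\qquad (u,v)|_{t=0}=(u_0,v_0).$$ Then there exists a pair of functions $g_1,g_2\in L^2(\mathbb{R})$ such that $$\lim_{t\to\infty}\int_{-\infty}^\infty |u(x,t)-u_0(x-t)-g_1(x-t)|^2\,dx=0$$ and $$\lim_{t\to\infty}\int_{-\infty}^\infty |v(x,t)-v_0(x+t)-g_2(x+t)|^2\,dx=0 .$$
   Context: The unknowns $u=u(x,t)$, $v=v(x,t)$ are complex valued, with $x\in\mathbb{R}$, $t\ge 0$, and $u_0,v_0\in L^2(\mathbb{R})$. The nonlinear terms are $N_1=\partial_{\overline u}W$, $N_2=\partial_{\overline v}W$ with $W(u,v)=\alpha|u|^2|v|^2+\beta(\overline u v+u\overline v)^2$; explicitly $$N_1(u,v)=\alpha u|v|^2+2\beta v(\overline u v+u\overline v),\qquad N_2(u,v)=\alpha |u|^2v+2\beta u(\overline u v+u\overline v).$$ Definition (strong solution). A pair $(u,v)\in C([0,\infty);L^2(\mathbb{R}))$ is a strong solution of the Cauchy problem on $\mathbb{R}\times[0,\infty)$ if there exists a sequence of classical solutions $(u^{(n)},v^{(n)})$ (i.e. $C^1$ on $\mathbb{R}\times[0,\infty)$) of the two differential equations on $\mathbb{R}\times[0,\infty)$ such that, for any $T>0$, $$\lim_{n\to\infty}\big(\|u^{(n)}-u\|_{L^2(\mathbb{R}\times[0,T])}+\|v^{(n)}-v\|_{L^2(\mathbb{R}\times[0,T])}\big)=0$$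 and $$\lim_{n\to\infty}\big(\|u^{(n)}(\cdot,0)-u_0\|_{L^2(\mathbb{R})}+\|v^{(n)}(\cdot,0)-v_0\|_{L^2(\mathbb{R})}\big)=0 .$$ *)

theory Defs
  imports "HOL-Analysis.Analysis"
begin

text \<open>Elements of \<open>L\<^sup>2\<close> are represented by functions, not by classes modulo null sets.\<close>

definition L2_space :: "'a measure \<Rightarrow> ('a \<Rightarrow> complex) set" where
  "L2_space M = {f \<in> borel_measurable M. integrable M (\<lambda>z. (cmod (f z))\<^sup>2)}"

definition L2_norm :: "'a measure \<Rightarrow> ('a \<Rightarrow> complex) \<Rightarrow> real" where
  "L2_norm M f = sqrt (LINT z|M. (cmod (f z))\<^sup>2)"

text \<open>\<open>C([0,\<infinity>); L\<^sup>2(\<real>))\<close> for \<open>u = u x t\<close>; values at \<open>t < 0\<close> are irrelevant.\<close>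

definition C_L2 :: "(real \<Rightarrow> real \<Rightarrow> complex) \<Rightarrow> bool" where
  "C_L2 u \<longleftrightarrow>
     (\<forall>t\<ge>0. (\<lambda>x. u x t) \<in> L2_space lebesgue) \<and>
     (\<forall>t\<ge>0. ((\<lambda>s. L2_norm lebesgue (\<lambda>x. u x s - u x t)) \<longlongrightarrow> 0) (at t within {0..}))"

text \<open>The time derivative is one-sided at \<open>t = 0\<close>.\<close>

definition dx :: "(real \<Rightarrow> real \<Rightarrow> complex) \<Rightarrow> real \<Rightarrow> real \<Rightarrow> complex" where
  "dx u x t = vector_derivative (\<lambda>y. u y t) (at x)"

definition dt :: "(real \<Rightarrow> real \<Rightarrow> complex) \<Rightarrow> real \<Rightarrow> real \<Rightarrow> complex" where
  "dt u x t = vector_derivative (\<lambda>s. u x s) (at t within {0..})"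

definition C1_halfplane :: "(real \<Rightarrow> real \<Rightarrow> complex) \<Rightarrow> bool" where
  "C1_halfplane u \<longleftrightarrow>
     (\<forall>x. \<forall>t\<ge>0. (\<lambda>y. u y t) differentiable (at x) \<and>
                 (\<lambda>s. u x s) differentiable (at t within {0..})) \<and>
     continuous_on (UNIV \<times> {0..}) (\<lambda>(x, t). u x t) \<and>
     continuous_on (UNIV \<times> {0..}) (\<lambda>(x, t). dx u x t) \<and>
     continuous_on (UNIV \<times> {0..}) (\<lambda>(x, t). dt u x t)"

text \<open>The nonlinear terms are the Wirtinger derivatives of
  \<open>W(u,v) = \<alpha> |u|\<^sup>2 |v|\<^sup>2 + \<beta> (cnj u * v + u * cnj v)\<^sup>2\<close>
  with respect to \<open>cnj u\<close> and \<open>cnj v\<close>.\<close>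

definition N1 :: "real \<Rightarrow> real \<Rightarrow> complex \<Rightarrow> complex \<Rightarrow> complex" where
  "N1 \<alpha> \<beta> u v = of_real \<alpha> * u * of_real ((cmod v)\<^sup>2) + 2 * of_real \<beta> * v * (cnj u * v + u * cnj v)"

definition N2 :: "real \<Rightarrow> real \<Rightarrow> complex \<Rightarrow> complex \<Rightarrow> complex" where
  "N2 \<alpha> \<beta> u v = of_real \<alpha> * of_real ((cmod u)\<^sup>2) * v + 2 * of_real \<beta> * u * (cnj u * v + u * cnj v)"

definition classical_solution ::
    "real \<Rightarrow> real \<Rightarrow> (real \<Rightarrow> real \<Rightarrow> complex) \<Rightarrow> (real \<Rightarrow> real \<Rightarrow> complex) \<Rightarrow> bool" where
  "classical_solution \<alpha> \<beta> u v \<longleftrightarrow>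
     C1_halfplane u \<and> C1_halfplane v \<and>
     (\<forall>x. \<forall>t\<ge>0. \<i> * (dt u x t + dx u x t) = N1 \<alpha> \<beta> (u x t) (v x t)) \<and>
     (\<forall>x. \<forall>t\<ge>0. \<i> * (dt v x t - dx v x t) = N2 \<alpha> \<beta> (u x t) (v x t))"

text \<open>Convergence in \<open>L\<^sup>2\<close> norm.  As \<^const>\<open>L2_norm\<close> is only meaningful on \<^const>\<open>L2_space\<close>,
  finiteness of the norm of the difference is required, but only for large \<open>n\<close> (a norm tending
  to \<open>0\<close> may be infinite for finitely many \<open>n\<close>).\<close>

definition L2_converges_pair ::
    "'a measure \<Rightarrow> (nat \<Rightarrow> 'a \<Rightarrow> complex) \<Rightarrow> ('a \<Rightarrow> complex) \<Rightarrow>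
     (nat \<Rightarrow> 'a \<Rightarrow> complex) \<Rightarrow> ('a \<Rightarrow> complex) \<Rightarrow> bool" where
  "L2_converges_pair M f' f g' g \<longleftrightarrow>
     (\<forall>\<^sub>F n in sequentially. (\<lambda>z. f' n z - f z) \<in> L2_space M \<and> (\<lambda>z. g' n z - g z) \<in> L2_space M) \<and>
     (\<lambda>n. L2_norm M (\<lambda>z. f' n z - f z) + L2_norm M (\<lambda>z. g' n z - g z)) \<longlonglongrightarrow> 0"

text \<open>Joint measurability of \<open>u\<close> and \<open>v\<close> on \<open>\<real> \<times> [0,T]\<close> is implied, since the approximants are
  continuous and the differences lie in \<open>L\<^sup>2(\<real> \<times> [0,T])\<close>.  Every element of
  \<open>C([0,\<infinity>); L\<^sup>2(\<real>))\<close> has a jointly measurable representative that is correct at each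
  \<open>t \<ge> 0\<close>, so this restricts only the choice of representative.\<close>

definition strong_solution ::
    "real \<Rightarrow> real \<Rightarrow> (real \<Rightarrow> complex) \<Rightarrow> (real \<Rightarrow> complex) \<Rightarrow>
     (real \<Rightarrow> real \<Rightarrow> complex) \<Rightarrow> (real \<Rightarrow> real \<Rightarrow> complex) \<Rightarrow> bool" where
  "strong_solution \<alpha> \<beta> u0 v0 u v \<longleftrightarrow>
     C_L2 u \<and> C_L2 v \<and>
     (\<exists>un vn :: nat \<Rightarrow> real \<Rightarrow> real \<Rightarrow> complex.
        (\<forall>n. classical_solution \<alpha> \<beta> (un n) (vn n)) \<and>
        (\<forall>T>0. L2_converges_pair (lebesgue_on (UNIV \<times> {0..T}))
                 (\<lambda>n (x, t). un n x t) (\<lambda>(x, t). u x t)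
                 (\<lambda>n (x, t). vn n x t) (\<lambda>(x, t). v x t)) \<and>
        L2_converges_pair lebesgue (\<lambda>n x. un n x 0) u0 (\<lambda>n x. vn n x 0) v0)"

end

theory Submission
  imports Defs
begin

text \<open>For a classical solution, \<open>|u|\<^sup>2 + |v|\<^sup>2\<close> is conserved with flux \<open>|u|\<^sup>2 - |v|\<^sup>2\<close>.  Integrating this
  law over a triangle one of whose sides is a right-moving characteristic bounds the integral of
  \<open>|v|\<^sup>2\<close> along that characteristic by half the initial mass.  Since \<open>|N\<^sub>1| \<le> c |u| |v|\<^sup>2\<close>, Gronwall's
  inequality along the characteristic gives the pointwise estimate
  \<open>|u(x+t,t) - u(x+s,s)| \<le> L |u(x,0)| \<integral>\<^sub>s\<^sup>t |v(x+\<tau>,\<tau>)|\<^sup>2 d\<tau>\<close>.  It survives the passage to strong solutions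
  (with \<open>2L\<close> instead of \<open>L\<close>), first for almost all times and then, as \<open>u\<close> is continuous into
  \<open>L\<^sup>2\<close>, for all times.  Hence \<open>u(x+t,t)\<close> converges for almost every \<open>x\<close> as \<open>t \<rightarrow> \<infinity>\<close>, and it differs
  from its limit by at most a constant times \<open>|u\<^sub>0(x)|\<close>, so the convergence is also in \<open>L\<^sup>2\<close>.  The
  reflection \<open>x \<mapsto> -x\<close> exchanges the roles of \<open>u\<close> and \<open>v\<close>.\<close>

section \<open>Classical solutions along characteristics\<close>

text \<open>What shapes the proof is how weak the approximation is: convergence in L2 on strips says
  nothing on an individual characteristic, which is a null set of the plane. The estimate therefore
  has on its right side only |u(x,0)| and an integral of |v|^2 along the line. Both can be
  controlled for almost every foot point x, because the shear (x,t) -> (x + \<sigma> t, t) preserves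
  Lebesgue measure. The constant \<open>L\<close> depends only on the coefficients and on a bound
  for the initial mass, so it serves all approximants at once, and two solutions are never compared
  with each other. Half of the mass appears because v crosses a right-moving line with relative
  speed 2, so that its flux through the line is 2|v|^2. The factor 2 in the limit comes from |a|^2
  <= 2|b|^2 + 2|a-b|^2; it is harmless, since only additivity in time and boundedness of the
  integral of |v|^2 are used afterwards. In the step to all times, continuity into L2 compares
  values at the same x, whereas the estimate compares values along a moving point; identifying the
  two limits needs an argument of its own.\<close>

lemma continuous_on_halfplane_compose:
  fixes h :: "real \<Rightarrow> real \<Rightarrow> 'a::topological_space"
  assumes "continuous_on (UNIV \<times> {0..}) (\<lambda>(x, t). h x t)"
    and "continuous_on S f" "continuous_on S g" "\<And>z. z \<in> S \<Longrightarrow> 0 \<le> g z"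
  shows "continuous_on S (\<lambda>z. h (f z) (g z))"
proof -
  have "continuous_on S (\<lambda>z. (f z, g z))"
    using assms by (intro continuous_intros)
  from continuous_on_compose2[OF assms(1) this] show ?thesis
    using assms(4) by auto
qed

text \<open>Fubini for \<open>f\<close> cut off by the indicator of the triangle, which is
  integrable because \<open>f\<close> is continuous on this compact set. It is stated for gauge
  integrals, the form in which the fundamental theorem of calculus delivers the inner integrals
  later.\<close>

lemma integral_triangle_swap:
  fixes f :: "real \<Rightarrow> real \<Rightarrow> real"
  assumes cont: "continuous_on {(x, y). a \<le> x \<and> x \<le> y \<and> y \<le> b} (\<lambda>(x, y). f x y)"
  shows "integral {a..b} (\<lambda>x. integral {x..b} (\<lambda>y. f x y)) =
         integral {a..b} (\<lambda>y. integral {a..y} (\<lambda>x. f x y))"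
proof -
  define S where "S = {(x, y). a \<le> x \<and> x \<le> y \<and> y \<le> b}"
  have closed: "closed S"
    unfolding S_def split_def by (intro closed_Collect_conj closed_Collect_le continuous_intros)
  moreover have "S \<subseteq> cbox (a, a) (b, b)" by (auto simp: S_def)
  ultimately have "compact S"
    by (meson bounded_cbox bounded_subset compact_eq_bounded_closed)
  with cont have "set_integrable lborel S (\<lambda>(x, y). f x y)"
    unfolding S_def[symmetric] by (rule borel_integrable_compact[folded set_integrable_def, rotated])
  then have int: "integrable (lborel \<Otimes>\<^sub>M lborel) (\<lambda>(x, y). indicator S (x, y) * f x y)"
    by (simp add: set_integrable_def lborel_prod split_def)
  have 1: "(LBINT y. indicator S (x, y) * f x y) = indicator {a..b} x * integral {x..b} (\<lambda>y. f x y)" for x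
  proof (cases "x \<in> {a..b}")
    case True
    then have "(\<lambda>y. indicator S (x, y) * f x y) = (\<lambda>y. indicator {x..b} y *\<^sub>R f x y)"
      by (auto simp: S_def indicator_def)
    moreover have "continuous_on {x..b} (\<lambda>y. f x y)"
      using True by (intro continuous_on_compose2[OF cont, of _ "\<lambda>y. (x, y)", simplified] continuous_intros) auto
    then have "set_integrable lborel {x..b} (\<lambda>y. f x y)"
      by (rule borel_integrable_atLeastAtMost')
    ultimately show ?thesis
      using True set_borel_integral_eq_integral(2)[of "{x..b}" "\<lambda>y. f x y"]
      by (simp add: set_lebesgue_integral_def)
  next
    case False
    then have "indicator S (x, y) = (0::real)" for y by (auto simp: S_def indicator_def)
    with False show ?thesis by simp
  qed
  have 2: "(LBINT x. indicator S (x, y) * f x y) = indicator {a..b} y * integral {a..y} (\<lambda>x. f x y)" for y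
  proof (cases "y \<in> {a..b}")
    case True
    then have "(\<lambda>x. indicator S (x, y) * f x y) = (\<lambda>x. indicator {a..y} x *\<^sub>R f x y)"
      by (auto simp: S_def indicator_def)
    moreover have "continuous_on {a..y} (\<lambda>x. f x y)"
      using True by (intro continuous_on_compose2[OF cont, of _ "\<lambda>x. (x, y)", simplified] continuous_intros) auto
    then have "set_integrable lborel {a..y} (\<lambda>x. f x y)"
      by (rule borel_integrable_atLeastAtMost')
    ultimately show ?thesis
      using True set_borel_integral_eq_integral(2)[of "{a..y}" "\<lambda>x. f x y"]
      by (simp add: set_lebesgue_integral_def)
  next
    case False
    then have "indicator S (x, y) = (0::real)" for x by (auto simp: S_def indicator_def)
    with False show ?thesis by simp
  qed
  have i1: "set_integrable lborel {a..b} (\<lambda>x. integral {x..b} (\<lambda>y. f x y))"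
    using lborel_pair.integrable_fst'[OF int] by (simp add: 1 set_integrable_def)
  have i2: "set_integrable lborel {a..b} (\<lambda>y. integral {a..y} (\<lambda>x. f x y))"
    using lborel_pair.integrable_snd[OF int] by (simp add: 2 set_integrable_def)
  show "integral {a..b} (\<lambda>x. integral {x..b} (\<lambda>y. f x y)) =
         integral {a..b} (\<lambda>y. integral {a..y} (\<lambda>x. f x y))"
    using lborel_pair.Fubini_integral[OF int] i1 i2
    by (simp add: 1 2 set_borel_integral_eq_integral(2)[symmetric] set_lebesgue_integral_def)
qed

text \<open>The divergence theorem for the field \<open>(a - b, a + b)\<close> on the triangle with vertices
  \<open>(2X, 0)\<close>, \<open>(2X + 2T, 0)\<close>, \<open>(2X + T, T)\<close>, written in the characteristic coordinates
  \<open>\<xi>, \<eta>\<close> with \<open>x = \<xi> + \<eta>\<close> and \<open>t = \<eta> - \<xi>\<close>.\<close>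

lemma characteristic_triangle:
  fixes a b r :: "real \<Rightarrow> real \<Rightarrow> real"
  assumes a: "\<And>c t. 0 \<le> t \<Longrightarrow>
      ((\<lambda>s. a (c + s) s) has_vector_derivative r (c + t) t) (at t within {0..})"
    and b: "\<And>c t. 0 \<le> t \<Longrightarrow>
      ((\<lambda>s. b (c - s) s) has_vector_derivative - r (c - t) t) (at t within {0..})"
    and cont_a: "continuous_on (UNIV \<times> {0..}) (\<lambda>(x, t). a x t)"
    and cont_b: "continuous_on (UNIV \<times> {0..}) (\<lambda>(x, t). b x t)"
    and cont_r: "continuous_on (UNIV \<times> {0..}) (\<lambda>(x, t). r x t)"
    and a_nonneg: "\<And>x t. 0 \<le> a x t"
    and "0 \<le> T"
  shows "integral {0..T} (\<lambda>t. b (2 * X + t) t) \<le> integral {X..X+T} (\<lambda>z. a (2 * z) 0 + b (2 * z) 0)"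
proof -
  define Y where "Y = X + T"
  have "X \<le> Y" using \<open>0 \<le> T\<close> by (simp add: Y_def)
  \<comment> \<open>With \<open>\<xi>\<close> fixed, x - t = 2 \<open>\<xi>\<close> is constant:
    \<open>\<eta>\<close> runs along a right-moving characteristic, where \<open>r\<close> is the
    derivative of \<open>a\<close>.\<close>
  have A: "integral {\<xi>..Y} (\<lambda>\<eta>. r (\<xi> + \<eta>) (\<eta> - \<xi>)) = a (\<xi> + Y) (Y - \<xi>) - a (2 * \<xi>) 0"
    if "\<xi> \<in> {X..Y}" for \<xi>
  proof -
    have "((\<lambda>\<eta>. r (\<xi> + \<eta>) (\<eta> - \<xi>)) has_integral a (\<xi> + Y) (Y - \<xi>) - a (\<xi> + \<xi>) (\<xi> - \<xi>)) {\<xi>..Y}"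
    proof (rule fundamental_theorem_of_calculus)
      show "\<xi> \<le> Y" using that by simp
      fix \<eta> assume \<eta>: "\<eta> \<in> {\<xi>..Y}"
      have "((\<lambda>s. a (2*\<xi> + s) s) \<circ> (\<lambda>\<eta>. \<eta> - \<xi>) has_vector_derivative 1 *\<^sub>R r (2*\<xi> + (\<eta> - \<xi>)) (\<eta> - \<xi>))
          (at \<eta> within {\<xi>..Y})"
      proof (rule vector_diff_chain_within)
        show "((\<lambda>\<eta>. \<eta> - \<xi>) has_vector_derivative 1) (at \<eta> within {\<xi>..Y})"
          by (auto intro!: derivative_eq_intros)
        show "((\<lambda>s. a (2 * \<xi> + s) s) has_vector_derivative r (2 * \<xi> + (\<eta> - \<xi>)) (\<eta> - \<xi>))
           (at (\<eta> - \<xi>) within (\<lambda>\<eta>. \<eta> - \<xi>) ` {\<xi>..Y})"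
          using \<eta> by (intro has_vector_derivative_within_subset[OF a]) auto
      qed
      then show "((\<lambda>\<eta>. a (\<xi> + \<eta>) (\<eta> - \<xi>)) has_vector_derivative r (\<xi> + \<eta>) (\<eta> - \<xi>)) (at \<eta> within {\<xi>..Y})"
        by (simp add: o_def algebra_simps)
    qed
    then show ?thesis by (simp add: integral_unique)
  qed
  \<comment> \<open>With \<open>\<eta>\<close> fixed, x + t = 2 \<open>\<eta>\<close> is constant.
    As \<open>\<xi>\<close> grows, time decreases along a left-moving characteristic, so the
    derivative \<open>- r\<close> of \<open>b\<close> enters with the opposite sign.\<close>
  have B: "integral {X..\<eta>} (\<lambda>\<xi>. r (\<xi> + \<eta>) (\<eta> - \<xi>)) = b (2 * \<eta>) 0 - b (X + \<eta>) (\<eta> - X)"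
    if "\<eta> \<in> {X..Y}" for \<eta>
  proof -
    have "((\<lambda>\<xi>. r (\<xi> + \<eta>) (\<eta> - \<xi>)) has_integral b (\<eta> + \<eta>) (\<eta> - \<eta>) - b (X + \<eta>) (\<eta> - X)) {X..\<eta>}"
    proof (rule fundamental_theorem_of_calculus)
      show "X \<le> \<eta>" using that by simp
      fix \<xi> assume \<xi>: "\<xi> \<in> {X..\<eta>}"
      have "((\<lambda>s. b (2*\<eta> - s) s) \<circ> (\<lambda>\<xi>. \<eta> - \<xi>) has_vector_derivative (- 1) *\<^sub>R (- r (2*\<eta> - (\<eta> - \<xi>)) (\<eta> - \<xi>)))
          (at \<xi> within {X..\<eta>})"
      proof (rule vector_diff_chain_within)
        show "((\<lambda>\<xi>. \<eta> - \<xi>) has_vector_derivative - 1) (at \<xi> within {X..\<eta>})"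
          by (auto intro!: derivative_eq_intros)
        show "((\<lambda>s. b (2 * \<eta> - s) s) has_vector_derivative - r (2 * \<eta> - (\<eta> - \<xi>)) (\<eta> - \<xi>))
           (at (\<eta> - \<xi>) within (\<lambda>\<xi>. \<eta> - \<xi>) ` {X..\<eta>})"
          using \<xi> by (intro has_vector_derivative_within_subset[OF b]) auto
      qed
      then show "((\<lambda>\<xi>. b (\<xi> + \<eta>) (\<eta> - \<xi>)) has_vector_derivative r (\<xi> + \<eta>) (\<eta> - \<xi>)) (at \<xi> within {X..\<eta>})"
        by (simp add: o_def algebra_simps)
    qed
    then show ?thesis by (simp add: integral_unique)
  qed
  have "continuous_on {(x, y). X \<le> x \<and> x \<le> y \<and> y \<le> Y} (\<lambda>(\<xi>, \<eta>). r (\<xi> + \<eta>) (\<eta> - \<xi>))"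
    unfolding split_def
    by (intro continuous_on_compose2[OF cont_r, of _ "\<lambda>z. (fst z + snd z, snd z - fst z)", simplified split_def fst_conv snd_conv] continuous_intros) auto
  note sw = integral_triangle_swap[OF this]
  have ai: "(\<lambda>\<xi>. a (\<xi> + Y) (Y - \<xi>)) integrable_on {X..Y}" "(\<lambda>\<xi>. a (2 * \<xi>) 0) integrable_on {X..Y}"
    and bi: "(\<lambda>\<eta>. b (X + \<eta>) (\<eta> - X)) integrable_on {X..Y}" "(\<lambda>\<eta>. b (2 * \<eta>) 0) integrable_on {X..Y}"
    by (auto intro!: integrable_continuous_interval continuous_on_halfplane_compose[OF cont_a]
        continuous_on_halfplane_compose[OF cont_b] continuous_intros)
  have "integral {X..Y} (\<lambda>\<xi>. a (\<xi> + Y) (Y - \<xi>) - a (2 * \<xi>) 0) =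
      integral {X..Y} (\<lambda>\<eta>. b (2 * \<eta>) 0 - b (X + \<eta>) (\<eta> - X))"
  proof -
    have "integral {X..Y} (\<lambda>\<xi>. a (\<xi> + Y) (Y - \<xi>) - a (2 * \<xi>) 0) =
        integral {X..Y} (\<lambda>\<xi>. integral {\<xi>..Y} (\<lambda>\<eta>. r (\<xi> + \<eta>) (\<eta> - \<xi>)))"
      by (intro Henstock_Kurzweil_Integration.integral_cong) (simp add: A)
    also have "\<dots> = integral {X..Y} (\<lambda>\<eta>. integral {X..\<eta>} (\<lambda>\<xi>. r (\<xi> + \<eta>) (\<eta> - \<xi>)))"
      by (rule sw)
    also have "\<dots> = integral {X..Y} (\<lambda>\<eta>. b (2 * \<eta>) 0 - b (X + \<eta>) (\<eta> - X))"
      by (intro Henstock_Kurzweil_Integration.integral_cong) (simp add: B)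
    finally show ?thesis .
  qed
  then have "integral {X..Y} (\<lambda>\<eta>. b (X + \<eta>) (\<eta> - X)) =
      integral {X..Y} (\<lambda>\<xi>. a (2 * \<xi>) 0 + b (2 * \<xi>) 0) - integral {X..Y} (\<lambda>\<xi>. a (\<xi> + Y) (Y - \<xi>))"
    using ai bi by (simp add: Henstock_Kurzweil_Integration.integral_diff Henstock_Kurzweil_Integration.integral_add)
  \<comment> \<open>The term dropped is the outgoing flux of \<open>a\<close> through the
    left-moving side of the triangle, which is nonnegative.\<close>
  also have "\<dots> \<le> integral {X..Y} (\<lambda>\<xi>. a (2 * \<xi>) 0 + b (2 * \<xi>) 0)"
    using ai by (simp add: Henstock_Kurzweil_Integration.integral_nonneg a_nonneg)
  finally have "integral {X..Y} (\<lambda>\<eta>. b (X + \<eta>) (\<eta> - X)) \<le> integral {X..Y} (\<lambda>\<xi>. a (2 * \<xi>) 0 + b (2 * \<xi>) 0)" .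
  moreover have "integral {0..T} (\<lambda>t. b (2 * X + t) t) = integral {X..Y} (\<lambda>\<eta>. b (X + \<eta>) (\<eta> - X))"
  proof -
    have "((\<lambda>\<eta>. b (X + \<eta>) (\<eta> - X)) has_integral integral {X..Y} (\<lambda>\<eta>. b (X + \<eta>) (\<eta> - X))) (cbox X Y)"
      using bi by (simp add: integrable_integral)
    from has_integral_affinity[OF this, of 1 X]
    have "((\<lambda>x. b (X + (x + X)) x) has_integral integral {X..Y} (\<lambda>\<eta>. b (X + \<eta>) (\<eta> - X))) {0..T}"
      using \<open>0 \<le> T\<close> by (simp add: Y_def)
    moreover have "X + (x + X) = 2 * X + x" for x by simp
    ultimately show ?thesis by (simp only: integral_unique)
  qed
  ultimately show ?thesis by (simp add: Y_def)
qed

section \<open>Total derivative and chain rule along straight lines in the closed half-plane\<close>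

lemma C1_halfplane_has_derivative:
  assumes "C1_halfplane u" and "0 \<le> t"
  shows "((\<lambda>(x, t). u x t) has_derivative (\<lambda>(h, k). h *\<^sub>R dx u x t + k *\<^sub>R dt u x t))
    (at (x, t) within UNIV \<times> {0..})"
proof -
  have "((\<lambda>(x, t). u x t) has_derivative
      (\<lambda>(h, k). h *\<^sub>R dx u x t + blinfun_apply (blinfun_scaleR_left (dt u x t)) k))
    (at (x, t) within UNIV \<times> {0..})"
  proof (rule has_derivative_partialsI)
    show "((\<lambda>x. u x t) has_derivative (\<lambda>h. h *\<^sub>R dx u x t)) (at x within UNIV)"
      using assms unfolding C1_halfplane_def dx_def
      by (simp add: vector_derivative_works has_vector_derivative_def)
    show "((\<lambda>y. u x y) has_derivative blinfun_apply (blinfun_scaleR_left (dt u x y))) (at y within {0..})"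
      if "x \<in> UNIV" "y \<in> {0..}" for x y
      using assms that unfolding C1_halfplane_def dt_def
      by (simp add: vector_derivative_works has_vector_derivative_def)
    \<comment> \<open>Continuity of \<open>dt u\<close> promotes the two partial derivatives to a
      total derivative. Everything is taken within the closed half-plane, since the time derivative
      is one-sided at t = 0.\<close>
    have "continuous (at (x, t) within UNIV \<times> {0..}) (\<lambda>(x, t). dt u x t)"
      using assms unfolding C1_halfplane_def by (simp add: continuous_on_eq_continuous_within)
    then show "continuous (at (x, t) within UNIV \<times> {0..}) (\<lambda>(x, t). blinfun_scaleR_left (dt u x t))"
      unfolding split_def continuous_within
      by (rule bounded_linear.tendsto[OF bounded_linear_blinfun_scaleR_left])
  qed (use assms in auto)
  then show ?thesis by simp
qed

lemma C1_halfplane_along_line: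
  assumes "C1_halfplane u" and "0 \<le> t"
  shows "((\<lambda>s. u (c + \<sigma> * s) s) has_vector_derivative dt u (c + \<sigma> * t) t + \<sigma> *\<^sub>R dx u (c + \<sigma> * t) t)
    (at t within {0..})"
proof -
  have "((\<lambda>s. (\<lambda>(x, t). u x t) (c + \<sigma> * s, s)) has_derivative
     (\<lambda>k. (\<lambda>(h, k). h *\<^sub>R dx u (c + \<sigma> * t) t + k *\<^sub>R dt u (c + \<sigma> * t) t) (\<sigma> * k, k))) (at t within {0..})"
  proof (rule has_derivative_in_compose[where f = "\<lambda>s. (c + \<sigma> * s, s)" and f' = "\<lambda>k. (\<sigma> * k, k)"])
    show "((\<lambda>s. (c + \<sigma> * s, s)) has_derivative (\<lambda>k. (\<sigma> * k, k))) (at t within {0..})"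
      by (auto intro!: derivative_eq_intros)
    show "((\<lambda>(x, t). u x t) has_derivative (\<lambda>(h, k). h *\<^sub>R dx u (c + \<sigma> * t) t + k *\<^sub>R dt u (c + \<sigma> * t) t))
     (at (c + \<sigma> * t, t) within (\<lambda>s. (c + \<sigma> * s, s)) ` {0..})"
      using assms by (intro has_derivative_subset[OF C1_halfplane_has_derivative]) auto
  qed
  then show ?thesis
    by (simp add: has_vector_derivative_def scaleR_add_right algebra_simps)
qed



text \<open>Infinitesimal form of the invariance of W under a common phase rotation of u and v:
  whatever the density |u|^2 gains along its characteristic, |v|^2 loses along its own.\<close>

lemma nonlinearity_exchange:
  "Re (cnj u * (- \<i> * N1 \<alpha> \<beta> u v)) = - Re (cnj v * (- \<i> * N2 \<alpha> \<beta> u v))"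
  unfolding N1_def N2_def by (simp add: cmod_power2 power2_eq_square algebra_simps)


text \<open>Up to conjugation every term of N1 has one factor u and two factors v. Being linear in
  |u|, the bound suits Gronwall with weight |v|^2. In 4|\<beta>| one factor 2 is the coefficient and
  the other comes from the bracket.\<close>

lemma cmod_N1_le: "cmod (N1 \<alpha> \<beta> u v) \<le> (\<bar>\<alpha>\<bar> + 4 * \<bar>\<beta>\<bar>) * cmod u * (cmod v)\<^sup>2"
proof -
  have "cmod (cnj u * v + u * cnj v) \<le> 2 * (cmod u * cmod v)"
    by (rule norm_triangle_le) (simp add: norm_mult)
  then have "cmod (2 * of_real \<beta> * v * (cnj u * v + u * cnj v)) \<le> 2 * \<bar>\<beta>\<bar> * cmod v * (2 * (cmod u * cmod v))"
    unfolding norm_mult by (intro mult_mono) auto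
  then show ?thesis
    unfolding N1_def
    by (intro order.trans[OF norm_triangle_ineq])
       (simp add: norm_mult norm_power power2_eq_square algebra_simps)
qed


text \<open>Gronwall first bounds |f| by a multiple of its initial value; inserting this into the
  bound for |f'| and integrating leaves the weight \<open>q\<close> as the only dependence on the
  time interval.\<close>

lemma linear_growth_variation:
  fixes f f' :: "real \<Rightarrow> complex" and q :: "real \<Rightarrow> real"
  assumes f: "\<And>t. 0 \<le> t \<Longrightarrow> (f has_vector_derivative f' t) (at t within {0..})"
    and f': "\<And>t. 0 \<le> t \<Longrightarrow> cmod (f' t) \<le> c * cmod (f t) * q t"
    and q: "continuous_on {0..} q" and q_nonneg: "\<And>t. 0 \<le> t \<Longrightarrow> 0 \<le> q t"
    and bound: "\<And>t. 0 \<le> t \<Longrightarrow> integral {0..t} q \<le> B"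
    and "0 \<le> c" "0 \<le> s" "s \<le> t"
  shows "cmod (f t - f s) \<le> c * exp (c * B) * cmod (f 0) * integral {s..t} q"
proof -
  define Q where "Q t = integral {0..t} q" for t
  have q': "continuous_on {0..T} q" for T
    by (rule continuous_on_subset[OF q]) auto
  have contf: "continuous_on {0..} f"
    using f by (meson atLeast_iff continuous_on_eq_continuous_within has_vector_derivative_continuous)
  have Q: "(Q has_real_derivative q t) (at t)" if "0 < t" for t
  proof -
    have "(Q has_real_derivative q t) (at t within {0..t+1})"
      unfolding Q_def[abs_def] has_real_derivative_iff_has_vector_derivative
      using that q' by (intro integral_has_vector_derivative) auto
    then show ?thesis
      using that by (simp add: at_within_Icc_at)
  qed
  have contQ: "continuous_on {0..T} Q" for T
    unfolding Q_def[abs_def] by (intro indefinite_integral_continuous_1 integrable_continuous_interval q')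
  have growth: "cmod (f t) \<le> exp (c * B) * cmod (f 0)" if t: "0 \<le> t" for t
  proof -
    \<comment> \<open>The integrating factor is applied to |f|^2 rather than |f|, which need not be
      differentiable where f vanishes.\<close>
    define \<phi> where "\<phi> t = (f t \<bullet> f t) * exp (- 2 * c * Q t)" for t
    have "\<phi> t \<le> \<phi> 0"
    proof (rule DERIV_nonpos_imp_decreasing_open[OF t])
      show "continuous_on {0..t} \<phi>"
        unfolding \<phi>_def[abs_def] by (intro continuous_intros contQ continuous_on_subset[OF contf]) auto
      fix x assume x: "0 < x" "x < t"
      then have "(f has_vector_derivative f' x) (at x)"
        using f[of x] at_within_interior[of x "{0..}"] by (simp add: interior_real_atLeast)
      then have f1: "(f has_derivative (\<lambda>h. h *\<^sub>R f' x)) (at x)"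
        by (simp add: has_vector_derivative_def)
      have "((\<lambda>t. f t \<bullet> f t) has_real_derivative 2 * (f x \<bullet> f' x)) (at x)"
        unfolding has_field_derivative_def
        by (rule has_derivative_eq_rhs[OF has_derivative_inner[OF f1 f1]])
           (simp add: fun_eq_iff inner_commute[of "f' x" "f x"])
      then have "(\<phi> has_real_derivative (2 * (f x \<bullet> f' x) - 2 * c * q x * (f x \<bullet> f x)) * exp (- 2 * c * Q x)) (at x)"
        unfolding \<phi>_def[abs_def]
        by (auto intro!: derivative_eq_intros Q[OF x(1)] simp: algebra_simps)
      moreover have "f x \<bullet> f' x \<le> c * q x * (f x \<bullet> f x)"
      proof -
        have "f x \<bullet> f' x \<le> cmod (f x) * cmod (f' x)"
          by (rule norm_cauchy_schwarz)
        also have "\<dots> \<le> cmod (f x) * (c * cmod (f x) * q x)"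
          using x f' by (intro mult_left_mono) auto
        finally show ?thesis by (simp add: dot_square_norm power2_eq_square algebra_simps)
      qed
      then have "(2 * (f x \<bullet> f' x) - 2 * c * q x * (f x \<bullet> f x)) * exp (- 2 * c * Q x) \<le> 0"
        by (intro mult_nonpos_nonneg) auto
      ultimately show "\<exists>y. (\<phi> has_real_derivative y) (at x) \<and> y \<le> 0" by blast
    qed
    then have "(cmod (f t))\<^sup>2 * exp (- 2 * c * Q t) \<le> (cmod (f 0))\<^sup>2"
      by (simp add: \<phi>_def Q_def dot_square_norm)
    then have "(cmod (f t))\<^sup>2 * exp (- 2 * c * Q t) * exp (2 * c * Q t) \<le> (cmod (f 0))\<^sup>2 * exp (2 * c * Q t)"
      by (intro mult_right_mono) auto
    also have "(cmod (f t))\<^sup>2 * exp (- 2 * c * Q t) * exp (2 * c * Q t) = (cmod (f t))\<^sup>2"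
      by (simp add: mult.assoc exp_add[symmetric])
    also have "(cmod (f 0))\<^sup>2 * exp (2 * c * Q t) = (exp (c * Q t) * cmod (f 0))\<^sup>2"
      by (simp add: power_mult_distrib exp_double[symmetric] mult.assoc)
    finally have "cmod (f t) \<le> exp (c * Q t) * cmod (f 0)"
      by (rule power2_le_imp_le) simp
    also have "\<dots> \<le> exp (c * B) * cmod (f 0)"
      using bound[OF t] \<open>0 \<le> c\<close> by (intro mult_right_mono) (simp_all add: Q_def mult_left_mono)
    finally show ?thesis .
  qed
  \<comment> \<open>The gauge integral of \<open>f'\<close> exists by the fundamental theorem alone,
    without continuity of \<open>f'\<close>.\<close>
  have "(f' has_integral (f t - f s)) {s..t}"
    using \<open>0 \<le> s\<close> \<open>s \<le> t\<close>
    by (intro fundamental_theorem_of_calculus has_vector_derivative_within_subset[OF f]) auto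
  moreover have "(\<lambda>x. c * exp (c * B) * cmod (f 0) * q x) integrable_on {s..t}"
    using \<open>0 \<le> s\<close> by (intro integrable_continuous_interval continuous_intros continuous_on_subset[OF q]) auto
  moreover have "cmod (f' x) \<le> c * exp (c * B) * cmod (f 0) * q x" if "x \<in> {s..t}" for x
  proof -
    have "0 \<le> x" using that \<open>0 \<le> s\<close> by simp
    have "cmod (f' x) \<le> c * cmod (f x) * q x" by (rule f') fact
    also have "\<dots> \<le> c * (exp (c * B) * cmod (f 0)) * q x"
      using growth[OF \<open>0 \<le> x\<close>] q_nonneg[OF \<open>0 \<le> x\<close>] \<open>0 \<le> c\<close> by (intro mult_right_mono mult_left_mono)
    finally show ?thesis by (simp add: mult.assoc)
  qed
  ultimately have "cmod (f t - f s) \<le> integral {s..t} (\<lambda>x. c * exp (c * B) * cmod (f 0) * q x)"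
    by (metis has_integral_integrable integral_norm_bound_integral integral_unique)
  then show ?thesis by simp
qed

lemma classical_solution_right_characteristics:
  assumes sol: "classical_solution \<alpha> \<beta> u v"
    and int: "integrable lebesgue (\<lambda>x. (cmod (u x 0))\<^sup>2)" "integrable lebesgue (\<lambda>x. (cmod (v x 0))\<^sup>2)"
    and mass: "(LINT x|lebesgue. (cmod (u x 0))\<^sup>2) + (LINT x|lebesgue. (cmod (v x 0))\<^sup>2) \<le> 2 * B"
  shows "0 \<le> t \<Longrightarrow> integral {0..t} (\<lambda>\<tau>. (cmod (v (x + \<tau>) \<tau>))\<^sup>2) \<le> B"
    and "0 \<le> s \<Longrightarrow> s \<le> t \<Longrightarrow> cmod (u (x + t) t - u (x + s) s) \<le>
      (\<bar>\<alpha>\<bar> + 4 * \<bar>\<beta>\<bar>) * exp ((\<bar>\<alpha>\<bar> + 4 * \<bar>\<beta>\<bar>) * B) * cmod (u x 0) *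
      integral {s..t} (\<lambda>\<tau>. (cmod (v (x + \<tau>) \<tau>))\<^sup>2)"
proof -
  have C1: "C1_halfplane u" "C1_halfplane v"
    using sol by (auto simp: classical_solution_def)
  have contu: "continuous_on (UNIV \<times> {0..}) (\<lambda>(x, t). u x t)"
    and contv: "continuous_on (UNIV \<times> {0..}) (\<lambda>(x, t). v x t)"
    using C1 by (auto simp: C1_halfplane_def)
  have du: "((\<lambda>s. u (x + s) s) has_vector_derivative - \<i> * N1 \<alpha> \<beta> (u (x + t) t) (v (x + t) t)) (at t within {0..})"
    if "0 \<le> t" for x t
  proof -
    have "\<i> * (dt u (x + t) t + dx u (x + t) t) = N1 \<alpha> \<beta> (u (x + t) t) (v (x + t) t)"
      using sol that by (auto simp: classical_solution_def)
    then have "- \<i> * (\<i> * (dt u (x + t) t + dx u (x + t) t)) = - \<i> * N1 \<alpha> \<beta> (u (x + t) t) (v (x + t) t)"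
      by (rule arg_cong)
    then have "dt u (x + t) t + dx u (x + t) t = - \<i> * N1 \<alpha> \<beta> (u (x + t) t) (v (x + t) t)"
      by (simp add: mult.assoc[symmetric] add.commute)
    with C1_halfplane_along_line[OF C1(1) that, of x 1] show ?thesis by simp
  qed
  have dv: "((\<lambda>s. v (x - s) s) has_vector_derivative - \<i> * N2 \<alpha> \<beta> (u (x - t) t) (v (x - t) t)) (at t within {0..})"
    if "0 \<le> t" for x t
  proof -
    have "\<i> * (dt v (x - t) t - dx v (x - t) t) = N2 \<alpha> \<beta> (u (x - t) t) (v (x - t) t)"
      using sol that by (auto simp: classical_solution_def)
    then have "- \<i> * (\<i> * (dt v (x - t) t - dx v (x - t) t)) = - \<i> * N2 \<alpha> \<beta> (u (x - t) t) (v (x - t) t)"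
      by (rule arg_cong)
    then have "dt v (x - t) t - dx v (x - t) t = - \<i> * N2 \<alpha> \<beta> (u (x - t) t) (v (x - t) t)"
      by (simp add: mult.assoc[symmetric] add.commute)
    with C1_halfplane_along_line[OF C1(2) that, of x "-1"] show ?thesis by simp
  qed
  \<comment> \<open>The rate of change of |u|^2 along right-moving lines and, by
    \<open>nonlinearity_exchange\<close>, minus that of |v|^2 along left-moving ones.\<close>
  define r where "r x t = 2 * Re (cnj (u x t) * (- \<i> * N1 \<alpha> \<beta> (u x t) (v x t)))" for x t
  have deriv_sq: "((\<lambda>s. (cmod (f s))\<^sup>2) has_vector_derivative 2 * Re (cnj (f t) * f')) (at t within S)"
    if "(f has_vector_derivative f') (at t within S)" for f :: "real \<Rightarrow> complex" and f' t S
  proof -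
    have "((\<lambda>s. f s \<bullet> f s) has_derivative (\<lambda>h. f t \<bullet> (h *\<^sub>R f') + (h *\<^sub>R f') \<bullet> f t)) (at t within S)"
      using that unfolding has_vector_derivative_def by (intro has_derivative_inner)
    moreover have "(\<lambda>h. f t \<bullet> (h *\<^sub>R f') + (h *\<^sub>R f') \<bullet> f t) = (\<lambda>h. h *\<^sub>R (2 * Re (cnj (f t) * f')))"
      by (simp add: fun_eq_iff inner_commute[of f' "f t"]) (simp add: inner_complex_def algebra_simps)
    ultimately show ?thesis
      by (simp add: has_vector_derivative_def dot_square_norm)
  qed
  show B: "integral {0..t} (\<lambda>\<tau>. (cmod (v (x + \<tau>) \<tau>))\<^sup>2) \<le> B" if "0 \<le> t" for x t
  proof -
    \<comment> \<open>\<open>characteristic_triangle\<close> starts its characteristic at 2X. The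
      resulting substitution z -> 2z in the initial mass produces the half that matches the bound 2
      * B of the hypothesis.\<close>
    define X where "X = x / 2"
    let ?E = "\<lambda>z. (cmod (u z 0))\<^sup>2 + (cmod (v z 0))\<^sup>2"
    have "integral {0..t} (\<lambda>\<tau>. (cmod (v (2 * X + \<tau>) \<tau>))\<^sup>2)
        \<le> integral {X..X + t} (\<lambda>z. (cmod (u (2 * z) 0))\<^sup>2 + (cmod (v (2 * z) 0))\<^sup>2)"
    proof (rule characteristic_triangle[where a = "\<lambda>x t. (cmod (u x t))\<^sup>2" and r = r])
      fix c t :: real assume "0 \<le> t"
      show "((\<lambda>s. (cmod (u (c + s) s))\<^sup>2) has_vector_derivative r (c + t) t) (at t within {0..})"
        unfolding r_def by (intro deriv_sq du \<open>0 \<le> t\<close>)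
      show "((\<lambda>s. (cmod (v (c - s) s))\<^sup>2) has_vector_derivative - r (c - t) t) (at t within {0..})"
        using deriv_sq[OF dv[OF \<open>0 \<le> t\<close>, of c]] by (simp only: r_def nonlinearity_exchange mult_minus_right[of 2] minus_minus)
    next
      show "continuous_on (UNIV \<times> {0..}) (\<lambda>(x, t). r x t)"
        using contu contv unfolding r_def N1_def split_def by (intro continuous_intros)
    qed (use contu contv that in \<open>auto simp: split_def intro!: continuous_intros\<close>)
    also have "\<dots> = (LINT z:{X..X+t}|lebesgue. ?E (2 * z))"
    proof -
      have "set_integrable lebesgue {X..X+t} (\<lambda>z. ?E (2 * z))"
        using int(1)[THEN lebesgue_integrable_real_affine, of 2 0] int(2)[THEN lebesgue_integrable_real_affine, of 2 0]
        unfolding set_integrable_def by (intro integrable_mult_indicator) auto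
      from set_lebesgue_integral_eq_integral(2)[OF this] show ?thesis by simp
    qed
    also have "\<dots> \<le> (LINT z|lebesgue. ?E (2 * z))"
      unfolding set_lebesgue_integral_def
      using int(1)[THEN lebesgue_integrable_real_affine, of 2 0] int(2)[THEN lebesgue_integrable_real_affine, of 2 0]
      by (intro integral_mono integrable_mult_indicator) (auto simp: indicator_def)
    also have "\<dots> = (LINT z|lebesgue. ?E z) / 2"
      using lebesgue_integral_real_affine[of 2 ?E 0] by simp
    also have "\<dots> \<le> B"
      using int mass by simp
    finally show ?thesis by (simp add: X_def)
  qed
  show "cmod (u (x + t) t - u (x + s) s) \<le>
      (\<bar>\<alpha>\<bar> + 4 * \<bar>\<beta>\<bar>) * exp ((\<bar>\<alpha>\<bar> + 4 * \<bar>\<beta>\<bar>) * B) * cmod (u x 0) *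
      integral {s..t} (\<lambda>\<tau>. (cmod (v (x + \<tau>) \<tau>))\<^sup>2)" if "0 \<le> s" "s \<le> t"
  proof -
    have "continuous_on {0..} (\<lambda>\<tau>. (cmod (v (x + \<tau>) \<tau>))\<^sup>2)"
      by (intro continuous_intros continuous_on_halfplane_compose[OF contv]) auto
    then show ?thesis
      using linear_growth_variation[where f = "\<lambda>t. u (x + t) t" and q = "\<lambda>\<tau>. (cmod (v (x + \<tau>) \<tau>))\<^sup>2"
          and c = "\<bar>\<alpha>\<bar> + 4 * \<bar>\<beta>\<bar>" and B = B, OF du _ _ _ B _ that]
      by (simp add: cmod_N1_le norm_mult)
  qed
qed

section \<open>Exchange of u and v by spatial reflection\<close>

lemma classical_solution_reflect:
  assumes "classical_solution \<alpha> \<beta> u v"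
  shows "classical_solution \<alpha> \<beta> (\<lambda>x t. v (- x) t) (\<lambda>x t. u (- x) t)"
proof -
  have C1: "C1_halfplane (\<lambda>x t. w (- x) t) \<and> (\<forall>x. \<forall>t\<ge>0. dx (\<lambda>x t. w (- x) t) x t = - dx w (- x) t)"
    if w: "C1_halfplane w" for w
  proof -
    have d: "((\<lambda>y. w (- y) t) has_vector_derivative - dx w (- x) t) (at x)" if "0 \<le> t" for x t
    proof -
      have "((\<lambda>y. w y t) has_vector_derivative dx w (- x) t) (at (- x))"
        using w that unfolding C1_halfplane_def dx_def by (simp add: vector_derivative_works)
      then show ?thesis
        using vector_diff_chain_at[of uminus "-1" x "\<lambda>y. w y t"] 
        by (simp add: o_def has_vector_derivative_minus[OF has_vector_derivative_id, unfolded id_def])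
    qed
    then have dx: "\<forall>x. \<forall>t\<ge>0. dx (\<lambda>x t. w (- x) t) x t = - dx w (- x) t"
      unfolding dx_def[of "\<lambda>x t. w (- x) t"] by (auto intro: vector_derivative_at)
    have refl: "continuous_on (UNIV \<times> {0..}) (\<lambda>(x, t). h (- x) t)"
      if "continuous_on (UNIV \<times> {0..}) (\<lambda>(x, t). h x t)" for h :: "real \<Rightarrow> real \<Rightarrow> complex"
      unfolding split_def by (intro continuous_on_halfplane_compose[OF that] continuous_intros) auto
    have "continuous_on (UNIV \<times> {0..}) (\<lambda>(x, t). - dx w (- x) t)"
      using w refl[of "dx w"] continuous_on_minus[of _ "\<lambda>(x, t). dx w (- x) t"]
      unfolding C1_halfplane_def by (simp add: split_def)
    moreover have "continuous_on (UNIV \<times> {0..}) (\<lambda>(x, t). dx (\<lambda>x t. w (- x) t) x t)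
        \<longleftrightarrow> continuous_on (UNIV \<times> {0..}) (\<lambda>(x, t). - dx w (- x) t)"
      using dx by (intro continuous_on_cong) auto
    ultimately have cdx: "continuous_on (UNIV \<times> {0..}) (\<lambda>(x, t). dx (\<lambda>x t. w (- x) t) x t)"
      by blast
    have cdt: "continuous_on (UNIV \<times> {0..}) (\<lambda>(x, t). dt (\<lambda>x t. w (- x) t) x t)"
      using w refl[of "dt w"] unfolding C1_halfplane_def by (simp add: dt_def[of "\<lambda>x. w (- x)"] dt_def[of w "- _", symmetric])
    have cw: "continuous_on (UNIV \<times> {0..}) (\<lambda>(x, t). w (- x) t)"
      using w refl[of w] unfolding C1_halfplane_def by blast
    have diff: "(\<lambda>y. w (- y) t) differentiable at x \<and> (\<lambda>s. w (- x) s) differentiable at t within {0..}"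
      if "0 \<le> t" for x t
      using w that differentiableI_vector[OF d[OF that]] unfolding C1_halfplane_def by blast
    show ?thesis
      using cw cdx cdt diff dx unfolding C1_halfplane_def by blast
  qed
  \<comment> \<open>W is symmetric in its arguments, so the nonlinear terms trade places; the sign
    change of \<open>dx\<close> interchanges the two transport operators accordingly.\<close>
  have swap: "N1 \<alpha> \<beta> b a = N2 \<alpha> \<beta> a b" for a b
    by (simp add: N1_def N2_def algebra_simps)
  have dt: "dt (\<lambda>x t. w (- x) t) x t = dt w (- x) t" for w x t
    by (simp add: dt_def)
  have "C1_halfplane u" "C1_halfplane v"
    using assms by (auto simp: classical_solution_def)
  note C1 = C1[OF this(1)] C1[OF this(2)]
  show ?thesis
    unfolding classical_solution_def
  proof (intro conjI allI impI)
    fix x t :: real assume t: "0 \<le> t"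
    show "\<i> * (dt (\<lambda>x t. v (- x) t) x t + dx (\<lambda>x t. v (- x) t) x t) = N1 \<alpha> \<beta> (v (- x) t) (u (- x) t)"
      using assms t C1(2) unfolding classical_solution_def swap dt by simp
    show "\<i> * (dt (\<lambda>x t. u (- x) t) x t - dx (\<lambda>x t. u (- x) t) x t) = N2 \<alpha> \<beta> (v (- x) t) (u (- x) t)"
      using assms t C1(1) unfolding classical_solution_def swap[symmetric] dt by simp
  qed (use C1 in blast)+
qed

lemma classical_solution_left_characteristics:
  assumes sol: "classical_solution \<alpha> \<beta> u v"
    and int: "integrable lebesgue (\<lambda>x. (cmod (u x 0))\<^sup>2)" "integrable lebesgue (\<lambda>x. (cmod (v x 0))\<^sup>2)"
    and mass: "(LINT x|lebesgue. (cmod (u x 0))\<^sup>2) + (LINT x|lebesgue. (cmod (v x 0))\<^sup>2) \<le> 2 * B"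
  shows "0 \<le> t \<Longrightarrow> integral {0..t} (\<lambda>\<tau>. (cmod (u (x - \<tau>) \<tau>))\<^sup>2) \<le> B"
    and "0 \<le> s \<Longrightarrow> s \<le> t \<Longrightarrow> cmod (v (x - t) t - v (x - s) s) \<le>
      (\<bar>\<alpha>\<bar> + 4 * \<bar>\<beta>\<bar>) * exp ((\<bar>\<alpha>\<bar> + 4 * \<bar>\<beta>\<bar>) * B) * cmod (v x 0) *
      integral {s..t} (\<lambda>\<tau>. (cmod (u (x - \<tau>) \<tau>))\<^sup>2)"
proof -
  have i: "integrable lebesgue (\<lambda>x. (cmod (v (- x) 0))\<^sup>2)" "integrable lebesgue (\<lambda>x. (cmod (u (- x) 0))\<^sup>2)"
    using int lebesgue_integrable_real_affine[of _ "-1" 0] by force+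
  have m: "(LINT x|lebesgue. (cmod (v (- x) 0))\<^sup>2) + (LINT x|lebesgue. (cmod (u (- x) 0))\<^sup>2) \<le> 2 * B"
    using mass lebesgue_integral_real_affine[of "-1" "\<lambda>x. (cmod (u x 0))\<^sup>2" 0]
      lebesgue_integral_real_affine[of "-1" "\<lambda>x. (cmod (v x 0))\<^sup>2" 0] by simp
  note r = classical_solution_right_characteristics[OF classical_solution_reflect[OF sol] i m]
  show "0 \<le> t \<Longrightarrow> integral {0..t} (\<lambda>\<tau>. (cmod (u (x - \<tau>) \<tau>))\<^sup>2) \<le> B"
    using r(1)[of t "- x"] by simp
  show "0 \<le> s \<Longrightarrow> s \<le> t \<Longrightarrow> cmod (v (x - t) t - v (x - s) s) \<le>
      (\<bar>\<alpha>\<bar> + 4 * \<bar>\<beta>\<bar>) * exp ((\<bar>\<alpha>\<bar> + 4 * \<bar>\<beta>\<bar>) * B) * cmod (v x 0) *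
      integral {s..t} (\<lambda>\<tau>. (cmod (u (x - \<tau>) \<tau>))\<^sup>2)"
    using r(2)[of s t "- x"] by simp
qed

section \<open>Passage to the limit along characteristics\<close>

text \<open>The classical subsequence theorem for L1 convergence, applied to \<open>enn2real\<close>
  of a shifted sequence. Values in \<open>ennreal\<close> are needed because fibre integrals along
  characteristics may be infinite, and eventual measurability because the differences lie in L2 only
  for large n.\<close>

lemma nn_integral_tendsto_0_AE_subseq:
  fixes f :: "nat \<Rightarrow> 'a \<Rightarrow> ennreal"
  assumes meas: "\<forall>\<^sub>F n in sequentially. f n \<in> borel_measurable M"
    and lim: "(\<lambda>n. \<integral>\<^sup>+x. f n x \<partial>M) \<longlonglongrightarrow> 0"
  shows "\<exists>r::nat \<Rightarrow> nat. strict_mono r \<and> (AE x in M. (\<lambda>n. f (r n) x) \<longlonglongrightarrow> 0)"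
proof -
  have "\<forall>\<^sub>F n in sequentially. (\<integral>\<^sup>+x. f n x \<partial>M) < 1"
    using lim by (rule order_tendstoD) simp
  with meas have "\<forall>\<^sub>F n in sequentially. f n \<in> borel_measurable M \<and> (\<integral>\<^sup>+x. f n x \<partial>M) < 1"
    by (rule eventually_conj)
  then obtain N where N: "\<And>n. n \<ge> N \<Longrightarrow> f n \<in> borel_measurable M" "\<And>n. n \<ge> N \<Longrightarrow> (\<integral>\<^sup>+x. f n x \<partial>M) < 1"
    unfolding eventually_sequentially by blast
  define g where "g n x = enn2real (f (n + N) x)" for n x
  have fin: "(\<integral>\<^sup>+x. f (n + N) x \<partial>M) \<noteq> \<infinity>" for n
    using N(2)[of "n + N"] by (auto simp: less_top[symmetric] dest: less_trans[OF _ ennreal_one_less_top])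
  have AE_fin: "AE x in M. f (n + N) x \<noteq> \<infinity>" for n
    using N(1)[of "n + N"] fin[of n] by (intro nn_integral_noteq_infinite) auto
  have g: "(\<integral>\<^sup>+x. ennreal (g n x) \<partial>M) = (\<integral>\<^sup>+x. f (n + N) x \<partial>M)" for n
    using AE_fin[of n] by (intro nn_integral_cong_AE) (auto simp: g_def less_top)
  have meas_g: "g n \<in> borel_measurable M" for n
    unfolding g_def[abs_def] using N(1)[of "n + N"] by measurable
  have int: "integrable M (g n)" for n
    using meas_g fin[of n] by (intro integrableI_nonneg) (auto simp: g less_top, simp add: g_def)
  have "(LINT x|M. norm (g n x)) = enn2real (\<integral>\<^sup>+x. f (n + N) x \<partial>M)" for n
    using meas_g[of n] g[of n] by (subst integral_eq_nn_integral) (auto simp: g_def[abs_def])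
  moreover have "(\<lambda>n. enn2real (\<integral>\<^sup>+x. f (n + N) x \<partial>M)) \<longlonglongrightarrow> enn2real 0"
    using LIMSEQ_ignore_initial_segment[OF lim, of N] by (intro tendsto_enn2real) auto
  ultimately have "(\<lambda>n. LINT x|M. norm (g n x)) \<longlonglongrightarrow> 0"
    by simp
  from tendsto_L1_AE_subseq[OF int this] obtain r :: "nat \<Rightarrow> nat"
    where r: "strict_mono r" "AE x in M. (\<lambda>n. g (r n) x) \<longlonglongrightarrow> 0" by auto
  have all_fin: "AE x in M. \<forall>n. f (n + N) x \<noteq> \<infinity>"
    using AE_fin by (simp add: AE_all_countable)
  have "AE x in M. (\<lambda>n. f (r n + N) x) \<longlonglongrightarrow> 0"
    using r(2) all_fin
  proof eventually_elim
    case (elim x)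
    have "(\<lambda>n. ennreal (g (r n) x)) \<longlonglongrightarrow> ennreal 0"
      using elim by (intro tendsto_ennrealI) auto
    moreover have "ennreal (g (r n) x) = f (r n + N) x" for n
      using elim by (simp add: g_def less_top)
    ultimately show ?case by simp
  qed
  moreover have "strict_mono (\<lambda>n. r n + N)"
    using r(1) by (simp add: strict_mono_def)
  ultimately show ?thesis by (intro exI[of _ "\<lambda>n. r n + N"]) simp
qed

section \<open>Elementary facts on L2 functions, null sets and shears\<close>

lemma L2_norm_power2: "f \<in> L2_space M \<Longrightarrow> (\<integral>\<^sup>+z. ennreal ((cmod (f z))\<^sup>2) \<partial>M) = ennreal ((L2_norm M f)\<^sup>2)"
  unfolding L2_space_def L2_norm_def by (subst nn_integral_eq_integral) auto

lemma L2_norm_tendsto_0_nn_integral: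
  assumes "\<forall>\<^sub>F n in F. f n \<in> L2_space M" and "((\<lambda>n. L2_norm M (f n)) \<longlongrightarrow> 0) F"
  shows "((\<lambda>n. \<integral>\<^sup>+z. ennreal ((cmod (f n z))\<^sup>2) \<partial>M) \<longlongrightarrow> 0) F"
proof -
  have "((\<lambda>n. ennreal ((L2_norm M (f n))\<^sup>2)) \<longlongrightarrow> ennreal (0\<^sup>2)) F"
    by (intro tendsto_ennrealI tendsto_power assms)
  moreover have "\<forall>\<^sub>F n in F. ennreal ((L2_norm M (f n))\<^sup>2) = (\<integral>\<^sup>+z. ennreal ((cmod (f n z))\<^sup>2) \<partial>M)"
    using assms(1) by (rule eventually_mono) (simp add: L2_norm_power2)
  ultimately show ?thesis
    by (simp add: tendsto_cong)
qed

lemma cmod_diff_square_le: "(cmod (a - b))\<^sup>2 \<le> 2 * (cmod a)\<^sup>2 + 2 * (cmod b)\<^sup>2"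
proof -
  have "(cmod (a - b))\<^sup>2 \<le> (cmod a + cmod b)\<^sup>2"
    by (intro power_mono norm_triangle_ineq4) auto
  also have "\<dots> \<le> 2 * (cmod a)\<^sup>2 + 2 * (cmod b)\<^sup>2"
    using sum_squares_bound[of "cmod a" "cmod b"] by (simp add: power2_sum)
  finally show ?thesis .
qed

lemma L2_space_diff:
  assumes "f \<in> L2_space M" "g \<in> L2_space M"
  shows "(\<lambda>z. f z - g z) \<in> L2_space M"
proof -
  have "integrable M (\<lambda>z. (cmod (f z - g z))\<^sup>2)"
  proof (rule Bochner_Integration.integrable_bound)
    show "integrable M (\<lambda>z. 2 * (cmod (f z))\<^sup>2 + 2 * (cmod (g z))\<^sup>2)"
      using assms by (auto simp: L2_space_def)
    show "(\<lambda>z. (cmod (f z - g z))\<^sup>2) \<in> borel_measurable M"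
      using assms by (auto simp: L2_space_def)
    show "AE z in M. norm ((cmod (f z - g z))\<^sup>2) \<le> norm (2 * (cmod (f z))\<^sup>2 + 2 * (cmod (g z))\<^sup>2)"
      by (simp add: cmod_diff_square_le)
  qed
  then show ?thesis using assms by (auto simp: L2_space_def)
qed

text \<open>\<open>P\<close> is an arbitrary predicate, so the set translated is a Borel null set
  containing the exceptions.\<close>

lemma AE_lborel_translate:
  fixes P :: "real \<Rightarrow> bool"
  assumes "AE x in lborel. P x"
  shows "AE x in lborel. P (x + c)"
proof -
  obtain N where N: "N \<in> sets borel" "emeasure lborel N = 0" "{x. \<not> P x} \<subseteq> N"
    using assms by (auto elim!: AE_E simp: space_lborel)
  then have "AE x in lborel. x \<notin> N"
    by (intro AE_not_in) (auto simp: null_sets_def)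
  moreover have "Measurable.pred borel (\<lambda>x. x \<notin> N)"
    using N(1) by measurable
  ultimately have "AE x in lborel. c + 1 * x \<notin> N"
    by (intro AE_borel_affine) auto
  then show ?thesis
    by (rule eventually_mono) (use N(3) in \<open>auto simp: add.commute\<close>)
qed

lemma completion_ex_borel_measurable_complex:
  fixes f :: "'a \<Rightarrow> complex"
  assumes "f \<in> borel_measurable (completion M)"
  shows "\<exists>g\<in>borel_measurable M. AE x in M. f x = g x"
proof -
  have "(\<lambda>x. Re (f x)) \<in> borel_measurable (completion M)" "(\<lambda>x. Im (f x)) \<in> borel_measurable (completion M)"
    using assms by measurable
  from this[THEN completion_ex_borel_measurable_real]
  obtain a b where ab [measurable]: "a \<in> borel_measurable M" "b \<in> borel_measurable M"
    and ae: "AE x in M. Re (f x) = a x" "AE x in M. Im (f x) = b x"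
    by blast
  have "(\<lambda>x. of_real (a x) + \<i> * of_real (b x)) \<in> borel_measurable M"
    by measurable
  moreover have "AE x in M. f x = of_real (a x) + \<i> * of_real (b x)"
    using ae by eventually_elim (simp add: complex_eq_iff)
  ultimately show ?thesis by (intro bexI[of _ "\<lambda>x. of_real (a x) + \<i> * of_real (b x)"])
qed

text \<open>A Lebesgue measurable function of the plane can lose measurability when restricted to a
  line. A Borel representative has measurable restrictions to every characteristic, and Tonelli
  applies to it after a shear. The strips [0,n+1] exhaust the half-plane, so the cut-off functions
  converge pointwise.\<close>

lemma halfplane_borel_representative:
  fixes v :: "real \<Rightarrow> real \<Rightarrow> complex"
  assumes "\<And>T. T > 0 \<Longrightarrow> (\<lambda>(x, t). v x t) \<in> borel_measurable (lebesgue_on (UNIV \<times> {0..T}))"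
  shows "\<exists>w\<in>borel_measurable borel. AE z in lborel. 0 \<le> snd z \<longrightarrow> w z = v (fst z) (snd z)"
proof -
  define g where "g T z = indicator (UNIV \<times> {0..T}) z *\<^sub>R (case z of (x, t) \<Rightarrow> v x t)" for T and z :: "real \<times> real"
  have S: "UNIV \<times> {0..T} \<in> sets (lebesgue :: (real \<times> real) measure)" for T :: real
    by (intro sets_completionI_sets) (auto intro!: borel_closed closed_Times)
  have "g (real (Suc n)) \<in> borel_measurable lebesgue" for n
    unfolding g_def[abs_def]
    by (rule borel_measurable_restrict_space_iff[THEN iffD1, OF _ assms]) (use S in auto)
  moreover have "(\<lambda>n. g (real (Suc n)) z) \<longlonglongrightarrow> indicator {z. 0 \<le> snd z} z *\<^sub>R (case z of (x, t) \<Rightarrow> v x t)" for z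
  proof (rule tendsto_eventually)
    obtain N where "snd z \<le> real N" using real_arch_simple by blast
    then show "\<forall>\<^sub>F n in sequentially. g (real (Suc n)) z = indicator {z. 0 \<le> snd z} z *\<^sub>R (case z of (x, t) \<Rightarrow> v x t)"
      unfolding eventually_sequentially
      by (intro exI[of _ N]) (auto simp: g_def indicator_def split: prod.splits)
  qed
  ultimately have "(\<lambda>z. indicator {z. 0 \<le> snd z} z *\<^sub>R (case z of (x, t) \<Rightarrow> v x t)) \<in> borel_measurable (lebesgue :: (real \<times> real) measure)"
    by (rule borel_measurable_LIMSEQ_metric)
  from completion_ex_borel_measurable_complex[OF this] obtain w where w: "w \<in> borel_measurable lborel"
    "AE z in lborel. indicator {z. 0 \<le> snd z} z *\<^sub>R (case z of (x, t) \<Rightarrow> v x t) = w z" by blast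
  from w(2) have "AE z in lborel. 0 \<le> snd z \<longrightarrow> w z = v (fst z) (snd z)"
    by eventually_elim (auto simp: indicator_def split: prod.splits)
  with w(1) show ?thesis by auto
qed

text \<open>After Tonelli the shear is a translation in x for each fixed t. This turns smallness in
  the plane into smallness along almost every characteristic.\<close>

lemma nn_integral_shear:
  fixes g :: "real \<times> real \<Rightarrow> ennreal"
  assumes [measurable]: "g \<in> borel_measurable borel"
  shows "(\<integral>\<^sup>+x. \<integral>\<^sup>+t. g (x + \<sigma> * t, t) \<partial>lborel \<partial>lborel) = (\<integral>\<^sup>+z. g z \<partial>lborel)"
    and "(\<lambda>x. \<integral>\<^sup>+t. g (x + \<sigma> * t, t) \<partial>lborel) \<in> borel_measurable lborel"
proof -
  have g: "g \<in> borel_measurable (lborel \<Otimes>\<^sub>M lborel)"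
    by (simp add: lborel_prod)
  have "continuous_on UNIV (\<lambda>z::real \<times> real. (fst z + \<sigma> * snd z, snd z))"
    by (intro continuous_intros)
  then have "(\<lambda>z. (fst z + \<sigma> * snd z, snd z)) \<in> borel_measurable borel"
    by (rule borel_measurable_continuous_onI)
  then have "(\<lambda>z. g (fst z + \<sigma> * snd z, snd z)) \<in> borel_measurable borel"
    using assms by (rule measurable_compose)
  then have sh: "(\<lambda>(x, t). g (x + \<sigma> * t, t)) \<in> borel_measurable (lborel \<Otimes>\<^sub>M lborel)"
    by (simp add: lborel_prod split_def)
  then show "(\<lambda>x. \<integral>\<^sup>+t. g (x + \<sigma> * t, t) \<partial>lborel) \<in> borel_measurable lborel"
    by (rule lborel.borel_measurable_nn_integral)
  have "(\<integral>\<^sup>+x. \<integral>\<^sup>+t. g (x + \<sigma> * t, t) \<partial>lborel \<partial>lborel) = (\<integral>\<^sup>+t. \<integral>\<^sup>+x. g (x + \<sigma> * t, t) \<partial>lborel \<partial>lborel)"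
    by (rule lborel_pair.Fubini'[OF sh, symmetric])
  also have "\<dots> = (\<integral>\<^sup>+t. \<integral>\<^sup>+x. g (x, t) \<partial>lborel \<partial>lborel)"
  proof (rule nn_integral_cong)
    fix t
    have "(\<lambda>x. g (x, t)) \<in> borel_measurable borel"
      using measurable_compose[OF measurable_Pair2'[of t lborel lborel] g] by simp
    from nn_integral_real_affine[OF this, of 1 "\<sigma> * t"]
    show "(\<integral>\<^sup>+x. g (x + \<sigma> * t, t) \<partial>lborel) = (\<integral>\<^sup>+x. g (x, t) \<partial>lborel)"
      by (simp add: add.commute)
  qed
  also have "\<dots> = (\<integral>\<^sup>+z. g z \<partial>lborel)"
    using lborel_pair.nn_integral_snd[OF g] by (simp add: lborel_prod)
  finally show "(\<integral>\<^sup>+x. \<integral>\<^sup>+t. g (x + \<sigma> * t, t) \<partial>lborel \<partial>lborel) = (\<integral>\<^sup>+z. g z \<partial>lborel)" .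
qed

text \<open>The order of quantifiers matters: whole time slices are wanted for almost every time.
  Exchanging them requires a measurable predicate, which a Borel null set containing the exceptions
  supplies.\<close>

lemma AE_lborel_prod_swap:
  assumes "AE z in (lborel :: (real \<times> real) measure). P (fst z) (snd z)"
  shows "AE t in lborel. AE x in lborel. P x t"
proof -
  obtain N where N: "N \<in> sets (lborel :: (real \<times> real) measure)" "emeasure lborel N = 0" "{z. \<not> P (fst z) (snd z)} \<subseteq> N"
    using assms by (auto elim!: AE_E simp: space_lborel)
  then have N': "N \<in> sets (lborel \<Otimes>\<^sub>M lborel)"
    by (simp only: lborel_prod)
  have "AE z in (lborel :: (real \<times> real) measure). z \<notin> N"
    using N by (intro AE_not_in) (auto simp: null_sets_def)
  then have "AE z in lborel \<Otimes>\<^sub>M lborel. z \<notin> N"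
    by (simp only: lborel_prod)
  then have "AE x in lborel. AE t in lborel. (x, t) \<notin> N"
    by (rule lborel_pair.AE_pair)
  moreover have "{z \<in> space (lborel \<Otimes>\<^sub>M lborel). (fst z, snd z) \<notin> N} \<in> sets (lborel \<Otimes>\<^sub>M lborel)"
  proof -
    have "{z \<in> space (lborel \<Otimes>\<^sub>M lborel). (fst z, snd z) \<notin> N} = space (lborel \<Otimes>\<^sub>M lborel) - N"
      by auto
    then show ?thesis
      by (simp only: sets.compl_sets[OF N'])
  qed
  ultimately have "AE t in lborel. AE x in lborel. (x, t) \<notin> N"
    by (subst (asm) lborel_pair.AE_commute) auto
  moreover have "P x t" if "(x, t) \<notin> N" for x t
  proof (rule ccontr)
    assume "\<not> P x t"
    then have "(x, t) \<in> {z. \<not> P (fst z) (snd z)}" by simp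
    with N(3) that show False by blast
  qed
  ultimately show ?thesis
    by (auto elim!: eventually_mono)
qed

text \<open>Everything follows from \<open>cmod_diff_square_le\<close>, applied to b = a - (a - b)
  and to a = b - (b - a). This is the source of the factors 2 in the limiting estimates.\<close>

lemma square_integrals_limit:
  fixes a :: "nat \<Rightarrow> real \<Rightarrow> complex" and b :: "real \<Rightarrow> complex"
  assumes a: "\<And>n. continuous_on {0..T} (a n)" and b: "b \<in> borel_measurable borel"
    and bound: "\<And>n. integral {0..T} (\<lambda>t. (cmod (a n t))\<^sup>2) \<le> B"
    and lim: "(\<lambda>n. \<integral>\<^sup>+t. ennreal (indicator {0..T} t * (cmod (a n t - b t))\<^sup>2) \<partial>lborel) \<longlonglongrightarrow> 0"
  shows "(\<lambda>t. (cmod (b t))\<^sup>2) integrable_on {0..T}"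
    and "integral {0..T} (\<lambda>t. (cmod (b t))\<^sup>2) \<le> 2 * B"
    and "\<exists>\<delta>. \<delta> \<longlonglongrightarrow> 0 \<and> (\<forall>\<^sub>F n in sequentially. \<forall>s\<ge>0. \<forall>t\<le>T.
      integral {s..t} (\<lambda>t. (cmod (a n t))\<^sup>2) \<le> 2 * integral {s..t} (\<lambda>t. (cmod (b t))\<^sup>2) + \<delta> n)"
proof -
  define e where "e n t = (cmod (a n t - b t))\<^sup>2" for n t
  define \<epsilon> where "\<epsilon> n = integral {0..T} (e n)" for n
  have meas: "(\<lambda>t. indicator {0..T} t *\<^sub>R e n t) \<in> borel_measurable borel"
    "(\<lambda>t. indicator {0..T} t *\<^sub>R (cmod (b t))\<^sup>2) \<in> borel_measurable borel" for n
  proof -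
    have [measurable]: "(\<lambda>t. indicator {0..T} t *\<^sub>R a n t) \<in> borel_measurable borel"
      using a by (intro borel_measurable_continuous_on_indicator) auto
    have "(\<lambda>t. indicator {0..T} t *\<^sub>R e n t) = (\<lambda>t. indicator {0..T} t *\<^sub>R (cmod (indicator {0..T} t *\<^sub>R a n t - b t))\<^sup>2)"
      by (auto simp: e_def indicator_def)
    moreover have "(\<lambda>t. indicator {0..T} t *\<^sub>R (cmod (indicator {0..T} t *\<^sub>R a n t - b t))\<^sup>2) \<in> borel_measurable borel"
      using b by measurable
    ultimately show "(\<lambda>t. indicator {0..T} t *\<^sub>R e n t) \<in> borel_measurable borel" by simp
    show "(\<lambda>t. indicator {0..T} t *\<^sub>R (cmod (b t))\<^sup>2) \<in> borel_measurable borel"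
      using b by measurable
  qed
  have "\<forall>\<^sub>F n in sequentially. (\<integral>\<^sup>+t. ennreal (indicator {0..T} t *\<^sub>R e n t) \<partial>lborel) < 1"
    using lim unfolding e_def by (intro order_tendstoD(2)[of _ 0]) auto
  then have ev: "\<forall>\<^sub>F n in sequentially. set_integrable lborel {0..T} (e n)"
  proof eventually_elim
    case (elim n)
    show ?case
      unfolding set_integrable_def
      using meas(1)[of n] elim
      by (intro integrableI_nonneg) (auto simp: e_def less_trans[OF _ ennreal_one_less_top])
  qed
  have \<epsilon>: "ennreal (\<epsilon> n) = (\<integral>\<^sup>+t. ennreal (indicator {0..T} t * (cmod (a n t - b t))\<^sup>2) \<partial>lborel)"
    if "set_integrable lborel {0..T} (e n)" for n
    using that set_borel_integral_eq_integral(2)[OF that]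
    by (simp add: \<epsilon>_def set_lebesgue_integral_def set_integrable_def e_def nn_integral_eq_integral)
  have \<epsilon>_lim: "\<epsilon> \<longlonglongrightarrow> 0"
  proof -
    have "\<forall>\<^sub>F n in sequentially. \<epsilon> n = enn2real (\<integral>\<^sup>+t. ennreal (indicator {0..T} t * (cmod (a n t - b t))\<^sup>2) \<partial>lborel)"
      using ev by eventually_elim (simp add: \<epsilon>[symmetric] \<epsilon>_def e_def set_borel_integral_eq_integral(1) Henstock_Kurzweil_Integration.integral_nonneg)
    moreover have "(\<lambda>n. enn2real (\<integral>\<^sup>+t. ennreal (indicator {0..T} t * (cmod (a n t - b t))\<^sup>2) \<partial>lborel)) \<longlonglongrightarrow> enn2real 0"
      using lim by (intro tendsto_enn2real) auto
    ultimately show ?thesis by (simp add: tendsto_cong)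
  qed
  have ai: "(\<lambda>t. (cmod (a n t))\<^sup>2) integrable_on {0..T}" "set_integrable lborel {0..T} (\<lambda>t. (cmod (a n t))\<^sup>2)" for n
    using a by (auto intro!: integrable_continuous_interval borel_integrable_atLeastAtMost' continuous_intros)
  have le1: "(cmod (b t))\<^sup>2 \<le> 2 * (cmod (a n t))\<^sup>2 + 2 * e n t" for n t
    using cmod_diff_square_le[of "a n t" "a n t - b t"] by (simp add: e_def)
  have le2: "(cmod (a n t))\<^sup>2 \<le> 2 * (cmod (b t))\<^sup>2 + 2 * e n t" for n t
    using cmod_diff_square_le[of "b t" "b t - a n t"] by (simp add: e_def norm_minus_commute)
  \<comment> \<open>A single good index suffices for integrability of |b|^2.\<close>
  obtain n where n: "set_integrable lborel {0..T} (e n)"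
    using eventually_happens[OF ev] by auto
  have "set_integrable lborel {0..T} (\<lambda>t. (cmod (b t))\<^sup>2)"
  proof (rule set_integrable_bound)
    show "set_integrable lborel {0..T} (\<lambda>t. 2 * (cmod (a n t))\<^sup>2 + 2 * e n t)"
      using ai(2) n by (intro set_integral_add set_integrable_mult_right) auto
    show "set_borel_measurable lborel {0..T} (\<lambda>t. (cmod (b t))\<^sup>2)"
      using meas(2) by (simp add: set_borel_measurable_def)
    show "AE t in lborel. t \<in> {0..T} \<longrightarrow> norm ((cmod (b t))\<^sup>2) \<le> norm (2 * (cmod (a n t))\<^sup>2 + 2 * e n t)"
      using le1[of _ n] by (auto simp: e_def)
  qed
  then show bi: "(\<lambda>t. (cmod (b t))\<^sup>2) integrable_on {0..T}"
    by (rule set_borel_integral_eq_integral(1))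
  have ei: "\<forall>\<^sub>F n in sequentially. e n integrable_on {0..T}"
    using ev by eventually_elim (rule set_borel_integral_eq_integral(1))
  have "\<forall>\<^sub>F n in sequentially. integral {0..T} (\<lambda>t. (cmod (b t))\<^sup>2) \<le> 2 * B + 2 * \<epsilon> n"
    using ei
  proof eventually_elim
    case (elim n)
    have "integral {0..T} (\<lambda>t. (cmod (b t))\<^sup>2) \<le> integral {0..T} (\<lambda>t. 2 * (cmod (a n t))\<^sup>2 + 2 * e n t)"
      using bi ai(1) elim le1 by (intro integral_le integrable_add integrable_on_mult_right) auto
    also have "\<dots> = 2 * integral {0..T} (\<lambda>t. (cmod (a n t))\<^sup>2) + 2 * \<epsilon> n"
      using ai(1) elim by (simp add: Henstock_Kurzweil_Integration.integral_add integrable_on_mult_right \<epsilon>_def)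
    finally show ?case using bound[of n] by simp
  qed
  moreover have "(\<lambda>n. 2 * B + 2 * \<epsilon> n) \<longlonglongrightarrow> 2 * B"
    using \<epsilon>_lim by (auto intro!: tendsto_eq_intros)
  ultimately show "integral {0..T} (\<lambda>t. (cmod (b t))\<^sup>2) \<le> 2 * B"
    by (intro tendsto_lowerbound[of _ "2 * B" sequentially]) auto
  have "\<forall>\<^sub>F n in sequentially. \<forall>s\<ge>0. \<forall>t\<le>T.
      integral {s..t} (\<lambda>t. (cmod (a n t))\<^sup>2) \<le> 2 * integral {s..t} (\<lambda>t. (cmod (b t))\<^sup>2) + 2 * \<epsilon> n"
    using ei
  proof eventually_elim
    case (elim n)
    show ?case
    proof (intro allI impI)
      fix s t :: real assume st: "0 \<le> s" "t \<le> T"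
      then have sub: "{s..t} \<subseteq> {0..T}" by auto
      note i = integrable_on_subinterval[OF _ sub]
      have "integral {s..t} (\<lambda>t. (cmod (a n t))\<^sup>2) \<le> integral {s..t} (\<lambda>t. 2 * (cmod (b t))\<^sup>2 + 2 * e n t)"
        using i[OF bi] i[OF ai(1)] i[OF elim] le2 by (intro integral_le integrable_add integrable_on_mult_right) auto
      also have "\<dots> = 2 * integral {s..t} (\<lambda>t. (cmod (b t))\<^sup>2) + 2 * integral {s..t} (e n)"
        using i[OF bi] i[OF elim] by (simp add: Henstock_Kurzweil_Integration.integral_add integrable_on_mult_right)
      also have "integral {s..t} (e n) \<le> \<epsilon> n"
        unfolding \<epsilon>_def using sub i[OF elim] elim by (intro integral_subset_le) (auto simp: e_def)
      finally show "integral {s..t} (\<lambda>t. (cmod (a n t))\<^sup>2) \<le> 2 * integral {s..t} (\<lambda>t. (cmod (b t))\<^sup>2) + 2 * \<epsilon> n"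
        by simp
    qed
  qed
  \<comment> \<open>The witness is \<delta> = 2\<epsilon>: the error is measured over all of [0,T]
    and is thereby uniform in s and t.\<close>
  moreover have "(\<lambda>n. 2 * \<epsilon> n) \<longlonglongrightarrow> 0"
    using \<epsilon>_lim by (auto intro!: tendsto_eq_intros)
  ultimately show "\<exists>\<delta>. \<delta> \<longlonglongrightarrow> 0 \<and> (\<forall>\<^sub>F n in sequentially. \<forall>s\<ge>0. \<forall>t\<le>T.
      integral {s..t} (\<lambda>t. (cmod (a n t))\<^sup>2) \<le> 2 * integral {s..t} (\<lambda>t. (cmod (b t))\<^sup>2) + \<delta> n)"
    by (intro exI[of _ "\<lambda>n. 2 * \<epsilon> n"]) simp
qed

text \<open>The two components pass to the limit in different senses. The values of u at the ends of
  a characteristic segment need pointwise convergence, available for almost all times only; v enters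
  through its square integral along the segment and needs L2 convergence on almost every fibre.
  Hence two successive subsequences, and a set \<open>G\<close> of good times.\<close>

lemma characteristic_variation_limit:
  fixes u v :: "real \<Rightarrow> real \<Rightarrow> complex" and un vn :: "nat \<Rightarrow> real \<Rightarrow> real \<Rightarrow> complex"
    and w :: "real \<times> real \<Rightarrow> complex"
  assumes cont_u: "\<And>n. continuous_on (UNIV \<times> {0..}) (\<lambda>(x, t). un n x t)"
    and cont_v: "\<And>n. continuous_on (UNIV \<times> {0..}) (\<lambda>(x, t). vn n x t)"
    and variation: "\<And>n x s t. 0 \<le> s \<Longrightarrow> s \<le> t \<Longrightarrow>
      cmod (un n (x + \<sigma> * t) t - un n (x + \<sigma> * s) s)
        \<le> L * cmod (un n x 0) * integral {s..t} (\<lambda>\<tau>. (cmod (vn n (x + \<sigma> * \<tau>) \<tau>))\<^sup>2)"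
    and bound: "\<And>n x t. 0 \<le> t \<Longrightarrow> integral {0..t} (\<lambda>\<tau>. (cmod (vn n (x + \<sigma> * \<tau>) \<tau>))\<^sup>2) \<le> B"
    and "0 \<le> L" and "0 < T"
    and w: "w \<in> borel_measurable borel" "AE z in lborel. 0 \<le> snd z \<longrightarrow> w z = v (fst z) (snd z)"
    and L2u: "\<forall>\<^sub>F n in sequentially. (\<lambda>z. (case z of (x, t) \<Rightarrow> un n x t) - (case z of (x, t) \<Rightarrow> u x t))
        \<in> L2_space (lebesgue_on (UNIV \<times> {0..T}))"
    and limu: "(\<lambda>n. L2_norm (lebesgue_on (UNIV \<times> {0..T}))
        (\<lambda>z. (case z of (x, t) \<Rightarrow> un n x t) - (case z of (x, t) \<Rightarrow> u x t))) \<longlonglongrightarrow> 0"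
    and L2v: "\<forall>\<^sub>F n in sequentially. (\<lambda>z. (case z of (x, t) \<Rightarrow> vn n x t) - (case z of (x, t) \<Rightarrow> v x t))
        \<in> L2_space (lebesgue_on (UNIV \<times> {0..T}))"
    and limv: "(\<lambda>n. L2_norm (lebesgue_on (UNIV \<times> {0..T}))
        (\<lambda>z. (case z of (x, t) \<Rightarrow> vn n x t) - (case z of (x, t) \<Rightarrow> v x t))) \<longlonglongrightarrow> 0"
    and L20: "\<forall>\<^sub>F n in sequentially. (\<lambda>x. un n x 0 - u0 x) \<in> L2_space lebesgue"
    and lim0: "(\<lambda>n. L2_norm lebesgue (\<lambda>x. un n x 0 - u0 x)) \<longlonglongrightarrow> 0"
  defines "q \<equiv> \<lambda>x \<tau>. (cmod (w (x + \<sigma> * \<tau>, \<tau>)))\<^sup>2"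
  shows "AE x in lborel. q x integrable_on {0..T} \<and> integral {0..T} (q x) \<le> 2 * B"
    and "\<exists>G. (AE t in lborel. t \<in> {0..T} \<longrightarrow> t \<in> G) \<and> (\<forall>s\<in>G. \<forall>t\<in>G. 0 \<le> s \<longrightarrow> s \<le> t \<longrightarrow> t \<le> T \<longrightarrow>
      (AE x in lborel. cmod (u (x + \<sigma> * t) t - u (x + \<sigma> * s) s) \<le> 2 * L * cmod (u0 x) * integral {s..t} (q x)))"
proof -
  define S where "S = (UNIV :: real set) \<times> {0..T}"
  have closed: "closed S"
    unfolding S_def by (intro closed_Times) auto
  have S [measurable]: "S \<in> sets borel" 
    using closed by (rule borel_closed)
  have S': "S \<inter> space lebesgue \<in> sets lebesgue"
    using S by auto

  define fu where "fu n z = ennreal ((cmod (un n (fst z) (snd z) - u (fst z) (snd z)))\<^sup>2)" for n z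
  have "(\<lambda>n. \<integral>\<^sup>+z. fu n z \<partial>lebesgue_on S) \<longlonglongrightarrow> 0"
    using L2_norm_tendsto_0_nn_integral[OF L2u limu] by (simp add: fu_def S_def split_def)
  moreover have "\<forall>\<^sub>F n in sequentially. fu n \<in> borel_measurable (lebesgue_on S)"
    using L2u by eventually_elim (auto simp: fu_def[abs_def] S_def L2_space_def split_def)
  ultimately obtain r1 :: "nat \<Rightarrow> nat" where r1: "strict_mono r1"
    and ae1: "AE z in lebesgue_on S. (\<lambda>n. fu (r1 n) z) \<longlonglongrightarrow> 0"
    using nn_integral_tendsto_0_AE_subseq[of fu] by blast
  define conv where "conv r x t \<longleftrightarrow> (\<lambda>n. fu (r n) (x, t)) \<longlonglongrightarrow> 0" for r :: "nat \<Rightarrow> nat" and x t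
  have "AE z in lebesgue. z \<in> S \<longrightarrow> (\<lambda>n. fu (r1 n) z) \<longlonglongrightarrow> 0"
    using ae1 by (subst (asm) AE_restrict_space_iff[OF S'])
  then have "AE z in lborel. z \<in> S \<longrightarrow> (\<lambda>n. fu (r1 n) z) \<longlonglongrightarrow> 0"
    by (simp add: AE_completion_iff)
  then have "AE t in lborel. AE x in lborel. (x, t) \<in> S \<longrightarrow> conv r1 x t"
    by (intro AE_lborel_prod_swap) (simp add: conv_def)
  then have good: "AE t in lborel. t \<in> {0..T} \<longrightarrow> (AE x in lborel. conv r1 x t)"
    by eventually_elim (auto simp: S_def)

  define h where "h n z = ennreal (indicator S z * (cmod (vn n (fst z) (snd z) - w z))\<^sup>2)" for n z
  have h_meas: "h n \<in> borel_measurable borel" for n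
  proof -
    have "continuous_on S (\<lambda>z. vn n (fst z) (snd z))"
      by (intro continuous_on_halfplane_compose[OF cont_v] continuous_intros) (auto simp: S_def)
    then have [measurable]: "(\<lambda>z. indicator S z *\<^sub>R vn n (fst z) (snd z)) \<in> borel_measurable borel"
      using S by (intro borel_measurable_continuous_on_indicator)
    have "h n = (\<lambda>z. ennreal (indicator S z * (cmod (indicator S z *\<^sub>R vn n (fst z) (snd z) - w z))\<^sup>2))"
      by (auto simp: h_def indicator_def)
    moreover have "\<dots> \<in> borel_measurable borel"
      using w(1) by measurable
    ultimately show ?thesis by simp
  qed
  have h_int: "(\<integral>\<^sup>+z. h n z \<partial>lborel) = (\<integral>\<^sup>+z. ennreal ((cmod ((case z of (x, t) \<Rightarrow> vn n x t) - (case z of (x, t) \<Rightarrow> v x t)))\<^sup>2) \<partial>lebesgue_on S)" for n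
  proof -
    have "(\<integral>\<^sup>+z. ennreal ((cmod ((case z of (x, t) \<Rightarrow> vn n x t) - (case z of (x, t) \<Rightarrow> v x t)))\<^sup>2) \<partial>lebesgue_on S)
        = (\<integral>\<^sup>+z. ennreal ((cmod ((case z of (x, t) \<Rightarrow> vn n x t) - (case z of (x, t) \<Rightarrow> v x t)))\<^sup>2) * indicator S z \<partial>lborel)"
      by (subst nn_integral_restrict_space[OF S']) (rule nn_integral_completion)
    also have "\<dots> = (\<integral>\<^sup>+z. h n z \<partial>lborel)"
    proof (rule nn_integral_cong_AE)
      show "AE z in lborel. ennreal ((cmod ((case z of (x, t) \<Rightarrow> vn n x t) - (case z of (x, t) \<Rightarrow> v x t)))\<^sup>2) * indicator S z = h n z"
        using w(2) by eventually_elim (auto simp: h_def S_def indicator_def split_def)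
    qed
    finally show ?thesis ..
  qed
  have h_lim: "(\<lambda>n. \<integral>\<^sup>+z. h n z \<partial>lborel) \<longlonglongrightarrow> 0"
    using L2_norm_tendsto_0_nn_integral[OF L2v limv] by (simp add: h_int S_def)
  \<comment> \<open>Squared L2 distance from \<open>vn n\<close> to \<open>w\<close> on the
    characteristic with foot point x, up to time T.\<close>
  define D where "D n x = (\<integral>\<^sup>+t. h n (x + \<sigma> * t, t) \<partial>lborel)" for n x
  define d0 where "d0 n x = ennreal ((cmod (un n x 0 - u0 x))\<^sup>2)" for n x
  have D_meas: "D n \<in> borel_measurable lebesgue" for n
    unfolding D_def[abs_def] by (intro measurable_completion nn_integral_shear(2) h_meas)
  have d0_meas: "\<forall>\<^sub>F n in sequentially. d0 n \<in> borel_measurable lebesgue"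
    using L20 by eventually_elim (auto simp: d0_def[abs_def] L2_space_def)
  \<comment> \<open>Adding the fibre distance and the error of the initial data lets one extraction
    serve both; each summand is later squeezed between 0 and the sum.\<close>
  have sum_meas: "\<forall>\<^sub>F n in sequentially. (\<lambda>x. D (r1 n) x + d0 (r1 n) x) \<in> borel_measurable lebesgue"
    using eventually_subseq[OF r1 d0_meas] by eventually_elim (use D_meas in measurable)
  have "(\<lambda>n. (\<integral>\<^sup>+z. h (r1 n) z \<partial>lborel) + (\<integral>\<^sup>+x. d0 (r1 n) x \<partial>lebesgue)) \<longlonglongrightarrow> 0 + 0"
    using LIMSEQ_subseq_LIMSEQ[OF h_lim r1] LIMSEQ_subseq_LIMSEQ[OF L2_norm_tendsto_0_nn_integral[OF L20 lim0] r1]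
    by (intro tendsto_add) (simp_all add: o_def d0_def)
  moreover have "\<forall>\<^sub>F n in sequentially. (\<integral>\<^sup>+z. h (r1 n) z \<partial>lborel) + (\<integral>\<^sup>+x. d0 (r1 n) x \<partial>lebesgue)
      = (\<integral>\<^sup>+x. D (r1 n) x + d0 (r1 n) x \<partial>lebesgue)"
    using eventually_subseq[OF r1 d0_meas]
  proof eventually_elim
    case (elim n)
    have "(\<integral>\<^sup>+x. D (r1 n) x \<partial>lebesgue) = (\<integral>\<^sup>+z. h (r1 n) z \<partial>lborel)"
      unfolding D_def by (simp only: nn_integral_completion nn_integral_shear(1)[OF h_meas])
    then show ?case
      using elim D_meas by (simp add: nn_integral_add)
  qed
  ultimately have "(\<lambda>n. \<integral>\<^sup>+x. D (r1 n) x + d0 (r1 n) x \<partial>lebesgue) \<longlonglongrightarrow> 0"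
    by (simp add: tendsto_cong)
  with sum_meas obtain r2 :: "nat \<Rightarrow> nat" where r2: "strict_mono r2"
    and ae2: "AE x in lebesgue. (\<lambda>n. D (r1 (r2 n)) x + d0 (r1 (r2 n)) x) \<longlonglongrightarrow> 0"
    using nn_integral_tendsto_0_AE_subseq[of "\<lambda>n x. D (r1 n) x + d0 (r1 n) x"] by blast
  define r where "r n = r1 (r2 n)" for n
  have conv_r: "conv r x t" if "conv r1 x t" for x t
    using LIMSEQ_subseq_LIMSEQ[OF that[unfolded conv_def] r2] by (simp add: conv_def r_def o_def)
  have sqrt_lim: "f \<longlonglongrightarrow> l" if "(\<lambda>n. ennreal ((cmod (f n - l))\<^sup>2)) \<longlonglongrightarrow> 0" for f :: "nat \<Rightarrow> complex" and l
  proof -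
    have "(\<lambda>n. (cmod (f n - l))\<^sup>2) \<longlonglongrightarrow> 0"
      using that tendsto_enn2real[of "\<lambda>n. ennreal ((cmod (f n - l))\<^sup>2)" 0] by simp
    then have "(\<lambda>n. sqrt ((cmod (f n - l))\<^sup>2)) \<longlonglongrightarrow> sqrt 0"
      by (intro tendsto_real_sqrt)
    then have "(\<lambda>n. f n - l) \<longlonglongrightarrow> 0"
      by (simp add: tendsto_norm_zero_iff)
    then show ?thesis by (simp add: LIM_zero_iff)
  qed
  define P where "P x \<longleftrightarrow> (\<lambda>n. D (r n) x) \<longlonglongrightarrow> 0 \<and> (\<lambda>n. un (r n) x 0) \<longlonglongrightarrow> u0 x" for x
  have "AE x in lborel. (\<lambda>n. D (r n) x + d0 (r n) x) \<longlonglongrightarrow> 0"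
    using ae2 by (simp add: AE_completion_iff r_def)
  then have AE_P: "AE x in lborel. P x"
  proof eventually_elim
    case (elim x)
    have "(\<lambda>n. D (r n) x) \<longlonglongrightarrow> 0" "(\<lambda>n. d0 (r n) x) \<longlonglongrightarrow> 0"
      by (rule tendsto_sandwich[OF _ _ tendsto_const elim]; simp)+
    then show ?case
      by (auto simp: P_def d0_def intro: sqrt_lim)
  qed
  have fibre: "q x integrable_on {0..T}" "integral {0..T} (q x) \<le> 2 * B"
    "\<exists>\<delta>. \<delta> \<longlonglongrightarrow> 0 \<and> (\<forall>\<^sub>F n in sequentially. \<forall>s\<ge>0. \<forall>t\<le>T.
      integral {s..t} (\<lambda>\<tau>. (cmod (vn (r n) (x + \<sigma> * \<tau>) \<tau>))\<^sup>2) \<le> 2 * integral {s..t} (q x) + \<delta> n)"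
    if "P x" for x
  proof -
    have "continuous_on {0..T} (\<lambda>\<tau>. vn (r n) (x + \<sigma> * \<tau>) \<tau>)" for n
      by (intro continuous_on_halfplane_compose[OF cont_v] continuous_intros) auto
    moreover have "(\<lambda>\<tau>. w (x + \<sigma> * \<tau>, \<tau>)) \<in> borel_measurable borel"
      by (intro measurable_compose[OF _ w(1)] borel_measurable_continuous_onI continuous_intros)
    moreover have "(\<lambda>n. \<integral>\<^sup>+t. ennreal (indicator {0..T} t * (cmod (vn (r n) (x + \<sigma> * t) t - w (x + \<sigma> * t, t)))\<^sup>2) \<partial>lborel) \<longlonglongrightarrow> 0"
      using that by (simp add: P_def D_def h_def S_def indicator_def)
    moreover have "integral {0..T} (\<lambda>\<tau>. (cmod (vn (r n) (x + \<sigma> * \<tau>) \<tau>))\<^sup>2) \<le> B" for n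
      using bound \<open>0 < T\<close> by simp
    ultimately show "q x integrable_on {0..T}" "integral {0..T} (q x) \<le> 2 * B"
      "\<exists>\<delta>. \<delta> \<longlonglongrightarrow> 0 \<and> (\<forall>\<^sub>F n in sequentially. \<forall>s\<ge>0. \<forall>t\<le>T.
      integral {s..t} (\<lambda>\<tau>. (cmod (vn (r n) (x + \<sigma> * \<tau>) \<tau>))\<^sup>2) \<le> 2 * integral {s..t} (q x) + \<delta> n)"
      using square_integrals_limit[of T "\<lambda>n \<tau>. vn (r n) (x + \<sigma> * \<tau>) \<tau>" "\<lambda>\<tau>. w (x + \<sigma> * \<tau>, \<tau>)" B]
      unfolding q_def by blast+
  qed
  show "AE x in lborel. q x integrable_on {0..T} \<and> integral {0..T} (q x) \<le> 2 * B"
    using AE_P by eventually_elim (simp add: fibre)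
  \<comment> \<open>Times whose slice converges for almost every x; the exceptional null set may
    depend on the time.\<close>
  define G where "G = {t. AE x in lborel. conv r1 x t}"
  have "AE x in lborel. cmod (u (x + \<sigma> * t) t - u (x + \<sigma> * s) s) \<le> 2 * L * cmod (u0 x) * integral {s..t} (q x)"
    if "s \<in> G" "t \<in> G" "0 \<le> s" "s \<le> t" "t \<le> T" for s t
  proof -
    \<comment> \<open>Slicewise convergence is translated so that x denotes the common foot point at
      time 0 instead of the position at times s and t.\<close>
    have "AE x in lborel. conv r1 (x + \<sigma> * s) s" "AE x in lborel. conv r1 (x + \<sigma> * t) t"
      using that AE_lborel_translate[of "\<lambda>x. conv r1 x s" "\<sigma> * s"] AE_lborel_translate[of "\<lambda>x. conv r1 x t" "\<sigma> * t"]
      by (simp_all add: G_def)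
    with AE_P show ?thesis
    proof eventually_elim
      case (elim x)
      obtain \<delta> where \<delta>: "\<delta> \<longlonglongrightarrow> 0" and ev: "\<forall>\<^sub>F n in sequentially. \<forall>s\<ge>0. \<forall>t\<le>T.
          integral {s..t} (\<lambda>\<tau>. (cmod (vn (r n) (x + \<sigma> * \<tau>) \<tau>))\<^sup>2) \<le> 2 * integral {s..t} (q x) + \<delta> n"
        using fibre(3)[OF elim(1)] by blast
      have lims: "(\<lambda>n. un (r n) (x + \<sigma> * s) s) \<longlonglongrightarrow> u (x + \<sigma> * s) s" "(\<lambda>n. un (r n) (x + \<sigma> * t) t) \<longlonglongrightarrow> u (x + \<sigma> * t) t"
        using conv_r[OF elim(2)] conv_r[OF elim(3)] by (auto simp: conv_def fu_def intro: sqrt_lim)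
      have lim0: "(\<lambda>n. un (r n) x 0) \<longlonglongrightarrow> u0 x"
        using elim(1) by (simp add: P_def)
      have "cmod (u (x + \<sigma> * t) t - u (x + \<sigma> * s) s) \<le> L * cmod (u0 x) * (2 * integral {s..t} (q x) + 0)"
      proof (rule tendsto_le)
        show "(\<lambda>n. cmod (un (r n) (x + \<sigma> * t) t - un (r n) (x + \<sigma> * s) s)) \<longlonglongrightarrow> cmod (u (x + \<sigma> * t) t - u (x + \<sigma> * s) s)"
          by (intro tendsto_intros lims)
        show "(\<lambda>n. L * cmod (un (r n) x 0) * (2 * integral {s..t} (q x) + \<delta> n))
            \<longlonglongrightarrow> L * cmod (u0 x) * (2 * integral {s..t} (q x) + 0)"
          by (intro tendsto_intros lim0 \<delta>)
        show "\<forall>\<^sub>F n in sequentially. cmod (un (r n) (x + \<sigma> * t) t - un (r n) (x + \<sigma> * s) s)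
            \<le> L * cmod (un (r n) x 0) * (2 * integral {s..t} (q x) + \<delta> n)"
          using ev
        proof eventually_elim
          case (elim n)
          have "cmod (un (r n) (x + \<sigma> * t) t - un (r n) (x + \<sigma> * s) s)
              \<le> L * cmod (un (r n) x 0) * integral {s..t} (\<lambda>\<tau>. (cmod (vn (r n) (x + \<sigma> * \<tau>) \<tau>))\<^sup>2)"
            using that by (intro variation)
          also have "\<dots> \<le> L * cmod (un (r n) x 0) * (2 * integral {s..t} (q x) + \<delta> n)"
            using elim that \<open>0 \<le> L\<close> by (intro mult_left_mono) auto
          finally show ?case .
        qed
      qed simp
      then show ?case by (simp add: mult_ac)
    qed
  qed
  moreover have "AE t in lborel. t \<in> {0..T} \<longrightarrow> t \<in> G"
    using good by (simp add: G_def)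
  ultimately show "\<exists>G. (AE t in lborel. t \<in> {0..T} \<longrightarrow> t \<in> G) \<and> (\<forall>s\<in>G. \<forall>t\<in>G. 0 \<le> s \<longrightarrow> s \<le> t \<longrightarrow> t \<le> T \<longrightarrow>
      (AE x in lborel. cmod (u (x + \<sigma> * t) t - u (x + \<sigma> * s) s) \<le> 2 * L * cmod (u0 x) * integral {s..t} (q x)))"
    by blast
qed

section \<open>Identification of the limit at every time\<close>

text \<open>Lebesgue differentiation: at almost every x the value of \<open>h\<close> is the limit
  of averages over intervals starting at x, and these averages all vanish.\<close>

lemma AE_lebesgue_zero_if_interval_integrals_zero:
  fixes h :: "real \<Rightarrow> complex"
  assumes "\<And>a b. set_integrable lebesgue {a..b} h"
    and "\<And>a b. (LINT x:{a..b}|lebesgue. h x) = 0"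
  shows "AE x in lebesgue. h x = 0"
proof -
  have "h integrable_on cbox a b" "integral {a..b} h = 0" for a b
    using set_lebesgue_integral_eq_integral[OF assms(1)[of a b]] assms(2)[of a b] by simp_all
  then obtain N where N: "negligible N" and
    lim: "\<And>x e. x \<notin> N \<Longrightarrow> 0 < e \<Longrightarrow> \<exists>d>0. \<forall>k. 0 < k \<and> k < d \<longrightarrow>
      norm (integral (cbox x (x + k *\<^sub>R One)) h /\<^sub>R k ^ DIM(real) - h x) < e"
    and zero: "\<And>a b. integral {a..b} h = 0"
    using integrable_ccontinuous_explicit[of h] by metis
  have "h x = 0" if x: "x \<notin> N" for x
  proof (rule ccontr)
    assume "h x \<noteq> 0"
    then obtain d where "d > 0" and d: "\<And>k. 0 < k \<Longrightarrow> k < d \<Longrightarrow>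
      norm (integral (cbox x (x + k *\<^sub>R One)) h /\<^sub>R k ^ DIM(real) - h x) < norm (h x)"
      using lim[OF x, of "norm (h x)"] by auto
    from d[of "d / 2"] \<open>d > 0\<close> show False
      by (simp add: zero)
  qed
  moreover have "AE x in lebesgue. x \<notin> N"
    using N by (intro AE_not_in) (simp add: negligible_iff_null_sets)
  ultimately show ?thesis
    by (auto elim: eventually_mono)
qed

section \<open>L2 convergence tested against indicators of intervals\<close>

lemma L2_space_translate:
  fixes f :: "real \<Rightarrow> complex"
  assumes "f \<in> L2_space lebesgue"
  shows "(\<lambda>x. f (x + c)) \<in> L2_space lebesgue"
  using assms lebesgue_integrable_real_affine[of "\<lambda>x. (cmod (f x))\<^sup>2" 1 c] borel_measurable_affine[of f 1 c]
  by (auto simp: L2_space_def add.commute)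

lemma interval_in_sets_lebesgue: "{a..b::real} \<in> sets lebesgue"
  by (intro sets_completionI_sets) simp

lemma integrable_lebesgue_indicator_interval: "integrable lebesgue (indicat_real {a..b::real})"
  by (rule integrable_real_indicator[OF interval_in_sets_lebesgue]) (simp add: emeasure_lborel_Icc_eq)

lemma L2_space_set_integrable:
  fixes f :: "real \<Rightarrow> complex"
  assumes "f \<in> L2_space lebesgue"
  shows "set_integrable lebesgue {a..b} f"
proof (rule set_integrable_bound)
  have "set_integrable lebesgue {a..b} (\<lambda>x. 1::real)"
    by (simp add: set_integrable_def integrable_lebesgue_indicator_interval)
  moreover have "set_integrable lebesgue {a..b} (\<lambda>x. (cmod (f x))\<^sup>2)"
    using assms unfolding set_integrable_def L2_space_def by (intro integrable_mult_indicator) auto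
  ultimately show "set_integrable lebesgue {a..b} (\<lambda>x. 1 + (cmod (f x))\<^sup>2)"
    by (rule set_integral_add)
  show "set_borel_measurable lebesgue {a..b} f"
    using assms unfolding set_borel_measurable_def L2_space_def
    by (intro borel_measurable_scaleR borel_measurable_indicator interval_in_sets_lebesgue) auto
  have "cmod (f x) \<le> 1 + (cmod (f x))\<^sup>2" for x
    using self_le_power[of "cmod (f x)" 2] by (cases "1 \<le> cmod (f x)") (auto simp: add_increasing2)
  then show "AE x in lebesgue. x \<in> {a..b} \<longrightarrow> norm (f x) \<le> norm (1 + (cmod (f x))\<^sup>2)"
    by auto
qed

text \<open>Instead of Cauchy-Schwarz, the elementary inequality d <= e + d^2/e is integrated over
  the interval with a free parameter e: the first term is small by the choice of e, the second by L2
  convergence.\<close>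

lemma L2_limit_interval_integral:
  fixes f :: "nat \<Rightarrow> real \<Rightarrow> complex"
  assumes f: "\<And>n. f n \<in> L2_space lebesgue" and g: "g \<in> L2_space lebesgue"
    and lim: "(\<lambda>n. L2_norm lebesgue (\<lambda>x. f n x - g x)) \<longlonglongrightarrow> 0"
  shows "(\<lambda>n. LINT x:{a..b}|lebesgue. f n x) \<longlonglongrightarrow> (LINT x:{a..b}|lebesgue. g x)"
proof -
  define N where "N n = L2_norm lebesgue (\<lambda>x. f n x - g x)" for n
  \<comment> \<open>Length of the interval; the maximum covers a > b, where it is empty.\<close>
  define l where "l = max 0 (b - a)"
  have int: "integrable lebesgue (\<lambda>x. (cmod (f n x - g x))\<^sup>2)" for n
    using L2_space_diff[OF f g] by (simp add: L2_space_def)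
  have N2: "(LINT x|lebesgue. (cmod (f n x - g x))\<^sup>2) = (N n)\<^sup>2" for n
    by (simp add: N_def L2_norm_def)
  have est: "cmod ((LINT x:{a..b}|lebesgue. f n x) - (LINT x:{a..b}|lebesgue. g x)) \<le> e * l + (N n)\<^sup>2 / e"
    if "0 < e" for e n
  proof -
    have si: "set_integrable lebesgue {a..b} (\<lambda>x. f n x - g x)"
      by (intro L2_space_set_integrable L2_space_diff f g)
    have "(LINT x:{a..b}|lebesgue. f n x) - (LINT x:{a..b}|lebesgue. g x) = (LINT x:{a..b}|lebesgue. f n x - g x)"
      by (intro set_integral_diff(2)[symmetric] L2_space_set_integrable f g)
    also have "cmod \<dots> \<le> (LINT x:{a..b}|lebesgue. cmod (f n x - g x))"
      using si by (rule set_integral_norm_bound)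
    also have "\<dots> \<le> (LINT x|lebesgue. e * indicator {a..b} x + (cmod (f n x - g x))\<^sup>2 / e)"
      unfolding set_lebesgue_integral_def
    proof (rule integral_mono)
      show "integrable lebesgue (\<lambda>x. indicator {a..b} x *\<^sub>R cmod (f n x - g x))"
        using set_integrable_norm[OF si] by (simp add: set_integrable_def)
      show "integrable lebesgue (\<lambda>x. e * indicator {a..b} x + (cmod (f n x - g x))\<^sup>2 / e)"
        using int integrable_lebesgue_indicator_interval
        by (intro Bochner_Integration.integrable_add integrable_mult_right integrable_divide)
      show "indicator {a..b} x *\<^sub>R cmod (f n x - g x) \<le> e * indicator {a..b} x + (cmod (f n x - g x))\<^sup>2 / e" for x
      proof -
        have "0 \<le> (cmod (f n x - g x) - e)\<^sup>2" "0 \<le> e * cmod (f n x - g x)" using that by auto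
        then have "e * cmod (f n x - g x) \<le> e * e + (cmod (f n x - g x))\<^sup>2"
          by (simp add: power2_eq_square algebra_simps)
        then show ?thesis
          using that by (auto simp: indicator_def field_simps)
      qed
    qed
    also have "\<dots> = e * l + (N n)\<^sup>2 / e"
      using int integrable_lebesgue_indicator_interval[of a b]
      by (subst Bochner_Integration.integral_add) (auto simp: N2 l_def max_def)
    finally show ?thesis .
  qed
  show ?thesis
  proof (rule LIMSEQ_I)
    fix r :: real assume "0 < r"
    define e where "e = r / (2 * (l + 1))"
    have l: "0 \<le> l" by (simp add: l_def)
    then have e: "0 < e" using \<open>0 < r\<close> by (simp add: e_def)
    have "e * l + (0\<^sup>2) / e < r"
      using l \<open>0 < r\<close> mult_nonneg_nonneg[of l r] by (simp add: e_def field_simps add_nonneg_pos)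
    moreover have "(\<lambda>n. e * l + (N n)\<^sup>2 / e) \<longlonglongrightarrow> e * l + (0\<^sup>2) / e"
      using e lim unfolding N_def by (intro tendsto_intros) auto
    ultimately have "\<forall>\<^sub>F n in sequentially. e * l + (N n)\<^sup>2 / e < r"
      by (intro order_tendstoD)
    then show "\<exists>no. \<forall>n\<ge>no. norm ((LINT x:{a..b}|lebesgue. f n x) - (LINT x:{a..b}|lebesgue. g x)) < r"
      unfolding eventually_sequentially using est[OF e] by (meson le_less_trans)
  qed
qed

text \<open>Convergence in \<open>L\<^sup>2\<close> in the fixed frame is compatible with dominated convergence in a moving
  frame: both limits are tested against indicators of intervals.\<close>

lemma moving_frame_limit:
  fixes U :: "real \<Rightarrow> real \<Rightarrow> complex"
  assumes L2: "\<And>k. (\<lambda>x. U x (s k)) \<in> L2_space lebesgue" "(\<lambda>x. U x t) \<in> L2_space lebesgue"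
    and lim: "(\<lambda>k. L2_norm lebesgue (\<lambda>x. U x (s k) - U x t)) \<longlonglongrightarrow> 0"
    and s: "s \<longlonglongrightarrow> t"
    and conv: "AE y in lebesgue. convergent (\<lambda>k. U (y + \<sigma> * s k) (s k))"
    and m: "\<And>a b. set_integrable lebesgue {a..b} m"
    and dom: "\<And>k. AE y in lebesgue. cmod (U (y + \<sigma> * s k) (s k)) \<le> m y"
  shows "AE y in lebesgue. (\<lambda>k. U (y + \<sigma> * s k) (s k)) \<longlonglongrightarrow> U (y + \<sigma> * t) t"
proof -
  define f where "f k y = U (y + \<sigma> * s k) (s k)" for k y
  define F where "F y = lim (\<lambda>k. f k y)" for y
  have f_meas: "f k \<in> borel_measurable lebesgue" for k
    using L2_space_translate[OF L2(1)[of k], of "\<sigma> * s k"] by (simp add: f_def[abs_def] L2_space_def)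
  have F_meas [measurable]: "F \<in> borel_measurable lebesgue"
    unfolding F_def[abs_def] using f_meas by (rule borel_measurable_lim_metric)
  have f_lim: "AE y in lebesgue. (\<lambda>k. f k y) \<longlonglongrightarrow> F y"
    using conv by eventually_elim (simp add: F_def f_def convergent_LIMSEQ_iff)
  have f_dom: "AE y in lebesgue. \<forall>k. cmod (f k y) \<le> m y"
    using dom by (simp add: AE_all_countable f_def)
  have F_dom: "AE y in lebesgue. cmod (F y) \<le> m y"
    using f_lim f_dom
  proof eventually_elim
    case (elim y)
    show ?case
      by (rule Lim_bounded[of "\<lambda>k. cmod (f k y)" _ 0]) (use elim in \<open>auto intro: tendsto_norm\<close>)
  qed
  have F_shift: "set_integrable lebesgue {a..b} (\<lambda>x. F (x - \<sigma> * t))" for a b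
  proof -
    have "set_integrable lebesgue {a - \<sigma> * t..b - \<sigma> * t} F"
    proof (rule set_integrable_bound[OF m])
      show "set_borel_measurable lebesgue {a - \<sigma> * t..b - \<sigma> * t} F"
        unfolding set_borel_measurable_def
        by (intro borel_measurable_scaleR borel_measurable_indicator interval_in_sets_lebesgue F_meas)
      show "AE x in lebesgue. x \<in> {a - \<sigma> * t..b - \<sigma> * t} \<longrightarrow> norm (F x) \<le> norm (m x)"
        using F_dom by eventually_elim auto
    qed
    then have "integrable lebesgue (\<lambda>x. indicator {a - \<sigma> * t..b - \<sigma> * t} (- (\<sigma> * t) + 1 * x) *\<^sub>R F (- (\<sigma> * t) + 1 * x))"
      unfolding set_integrable_def by (rule lebesgue_integrable_real_affine) simp
    moreover have "indicator {a - \<sigma> * t..b - \<sigma> * t} (- (\<sigma> * t) + 1 * x) = (indicator {a..b} x :: real)" for x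
      by (auto simp: indicator_def)
    ultimately show ?thesis
      by (simp add: set_integrable_def)
  qed
  \<comment> \<open>The shifts are bounded, so all moving intervals lie in one fixed interval, on
    which \<open>m\<close> is integrable and dominates.\<close>
  obtain R where R: "\<And>k. \<bar>\<sigma> * s k\<bar> \<le> R"
  proof -
    have "convergent (\<lambda>k. \<sigma> * s k)"
      using s by (intro convergentI[of _ "\<sigma> * t"] tendsto_intros)
    then obtain K where "\<forall>k. norm (\<sigma> * s k) \<le> K"
      by (meson BseqE convergent_imp_Bseq)
    then show ?thesis by (intro that[of K]) simp
  qed
  \<comment> \<open>One sequence of integrals is computed in both frames: L2 convergence gives the
    left side as its limit, dominated convergence after the shift gives the right side.\<close>
  have tests: "(LINT x:{a..b}|lebesgue. U x t) = (LINT x:{a..b}|lebesgue. F (x - \<sigma> * t))" for a b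
  proof (rule LIMSEQ_unique)
    show "(\<lambda>k. LINT x:{a..b}|lebesgue. U x (s k)) \<longlonglongrightarrow> (LINT x:{a..b}|lebesgue. U x t)"
      by (rule L2_limit_interval_integral[OF L2 lim])
    have shift: "(LINT x:{a..b}|lebesgue. g x) = (LINT y|lebesgue. indicator {a..b} (y + c) *\<^sub>R g (y + c))"
      for g :: "real \<Rightarrow> complex" and c
      using lebesgue_integral_real_affine[of 1 "\<lambda>x. indicator {a..b} x *\<^sub>R g x" c]
      by (simp add: set_lebesgue_integral_def add.commute)
    have "(\<lambda>k. LINT y|lebesgue. indicator {a..b} (y + \<sigma> * s k) *\<^sub>R f k y)
        \<longlonglongrightarrow> (LINT y|lebesgue. indicator {a..b} (y + \<sigma> * t) *\<^sub>R F y)"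
    proof (rule integral_dominated_convergence)
      show "integrable lebesgue (\<lambda>y. indicator {a - R..b + R} y *\<^sub>R m y)"
        using m by (simp add: set_integrable_def)
      have ind [measurable]: "(\<lambda>y. indicator {a..b} (y + c) :: real) \<in> borel_measurable lebesgue" for c
        by (intro measurable_completion) measurable
      show "(\<lambda>y. indicator {a..b} (y + \<sigma> * t) *\<^sub>R F y) \<in> borel_measurable lebesgue"
        by (intro borel_measurable_scaleR ind F_meas)
      show "(\<lambda>y. indicator {a..b} (y + \<sigma> * s k) *\<^sub>R f k y) \<in> borel_measurable lebesgue" for k
        by (intro borel_measurable_scaleR ind f_meas)
      show "AE y in lebesgue. norm (indicator {a..b} (y + \<sigma> * s k) *\<^sub>R f k y) \<le> indicator {a - R..b + R} y *\<^sub>R m y" for k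
        using f_dom
      proof eventually_elim
        case (elim y)
        have "0 \<le> m y" using elim[rule_format, of k] norm_ge_zero order_trans by blast
        then show ?case
          using elim[rule_format, of k] R[of k] by (auto simp: indicator_def)
      qed
      \<comment> \<open>Away from the two endpoints the indicator of the moving interval is
        eventually constant in k.\<close>
      have "AE y in lebesgue. y \<notin> {a - \<sigma> * t, b - \<sigma> * t}"
        by (intro AE_not_in) (simp flip: negligible_iff_null_sets)
      then show "AE y in lebesgue. (\<lambda>k. indicator {a..b} (y + \<sigma> * s k) *\<^sub>R f k y) \<longlonglongrightarrow> indicator {a..b} (y + \<sigma> * t) *\<^sub>R F y"
        using f_lim
      proof eventually_elim
        case (elim y)
        have y: "(\<lambda>k. y + \<sigma> * s k) \<longlonglongrightarrow> y + \<sigma> * t"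
          by (intro tendsto_intros s)
        have "\<forall>\<^sub>F k in sequentially. (indicator {a..b} (y + \<sigma> * s k) :: real) = indicator {a..b} (y + \<sigma> * t)"
        proof -
          consider "y + \<sigma> * t < a" | "b < y + \<sigma> * t" | "a < y + \<sigma> * t" "y + \<sigma> * t < b"
            using elim(1) by fastforce
          then show ?thesis
          proof cases
            case 1
            from order_tendstoD(2)[OF y 1] show ?thesis
              by eventually_elim (use 1 in auto)
          next
            case 2
            from order_tendstoD(1)[OF y 2] show ?thesis
              by eventually_elim (use 2 in auto)
          next
            case 3
            from order_tendstoD(1)[OF y 3(1)] order_tendstoD(2)[OF y 3(2)] show ?thesis
              by eventually_elim (use 3 in auto)
          qed
        qed
        then have "(\<lambda>k. indicator {a..b} (y + \<sigma> * s k) :: real) \<longlonglongrightarrow> indicator {a..b} (y + \<sigma> * t)"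
          by (rule tendsto_eventually)
        then show ?case
          by (intro tendsto_scaleR elim)
      qed
    qed
    then show "(\<lambda>k. LINT x:{a..b}|lebesgue. U x (s k)) \<longlonglongrightarrow> (LINT x:{a..b}|lebesgue. F (x - \<sigma> * t))"
      using shift[of "\<lambda>x. U x (s _)" "\<sigma> * s _"] shift[of "\<lambda>x. F (x - \<sigma> * t)" "\<sigma> * t"]
      by (simp add: f_def)
  qed
  have "AE x in lebesgue. U x t - F (x - \<sigma> * t) = 0"
  proof (rule AE_lebesgue_zero_if_interval_integrals_zero)
    note i = L2_space_set_integrable[OF L2(2)] F_shift
    show "set_integrable lebesgue {a..b} (\<lambda>x. U x t - F (x - \<sigma> * t))" for a b
      by (intro set_integral_diff(1) i)
    show "(LINT x:{a..b}|lebesgue. U x t - F (x - \<sigma> * t)) = 0" for a b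
      by (subst set_integral_diff(2)) (auto intro: i simp: tests)
  qed
  then have "AE y in lebesgue. U (y + \<sigma> * t) t = F y"
    using AE_lborel_translate[of "\<lambda>x. U x t = F (x - \<sigma> * t)" "\<sigma> * t"]
    by (simp add: AE_completion_iff)
  with f_lim show ?thesis
    by eventually_elim (simp add: f_def)
qed

lemma AE_interval_ex:
  fixes a b :: real
  assumes "AE t in lborel. t \<in> {a..b} \<longrightarrow> P t" and "a < b"
  shows "\<exists>t\<in>{a..b}. P t"
proof (rule ccontr)
  assume "\<not> ?thesis"
  with assms(1) have "AE t in lborel. t \<notin> {a..b}"
    by (auto elim!: eventually_mono)
  moreover have "{t \<in> space lborel. \<not> t \<notin> {a..b}} = {a..b}"
    by auto
  ultimately have "emeasure lborel {a..b} = 0"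
    using AE_iff_measurable[of "{a..b}" lborel "\<lambda>t. t \<notin> {a..b}"] by simp
  with \<open>a < b\<close> show False by simp
qed

lemma convergent_if_variation_le:
  fixes f :: "nat \<Rightarrow> 'a::banach" and p :: "nat \<Rightarrow> real"
  assumes "convergent p" and "0 \<le> c" and le: "\<And>m n. norm (f m - f n) \<le> c * \<bar>p m - p n\<bar>"
  shows "convergent f"
proof (intro Cauchy_convergent CauchyI)
  fix e :: real assume "0 < e"
  have "Cauchy p"
    using assms(1) by (simp add: Cauchy_convergent_iff)
  \<comment> \<open>Dividing by c + 1 keeps the case c = 0 uniform with the rest.\<close>
  from CauchyD[OF this, of "e / (c + 1)"] obtain M
    where M: "\<And>m n. m \<ge> M \<Longrightarrow> n \<ge> M \<Longrightarrow> \<bar>p m - p n\<bar> < e / (c + 1)"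
    using \<open>0 < e\<close> \<open>0 \<le> c\<close> by auto
  have "norm (f m - f n) < e" if "m \<ge> M" "n \<ge> M" for m n
  proof -
    have "norm (f m - f n) \<le> c * \<bar>p m - p n\<bar>" by (rule le)
    also have "\<dots> \<le> (c + 1) * \<bar>p m - p n\<bar>" by (intro mult_right_mono) auto
    also have "\<dots> < e" using M[OF that] \<open>0 \<le> c\<close> by (simp add: field_simps)
    finally show ?thesis .
  qed
  then show "\<exists>M. \<forall>m\<ge>M. \<forall>n\<ge>M. norm (f m - f n) < e" by blast
qed

text \<open>The limit in \<open>C_L2\<close> ignores the value at t itself, while a sequence may hit
  t. As the difference vanishes there, the limit is genuine continuity and passes to every
  sequence.\<close>

lemma C_L2_sequence:
  assumes u: "C_L2 u" and "0 \<le> t" and g: "\<And>k. 0 \<le> g k" "g \<longlonglongrightarrow> t"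
  shows "(\<lambda>k. L2_norm lebesgue (\<lambda>x. u x (g k) - u x t)) \<longlonglongrightarrow> 0"
proof -
  define \<phi> where "\<phi> s = L2_norm lebesgue (\<lambda>x. u x s - u x t)" for s
  have "\<phi> t = 0"
    by (simp add: \<phi>_def L2_norm_def)
  moreover have "(\<phi> \<longlongrightarrow> 0) (at t within {0..})"
    using u \<open>0 \<le> t\<close> by (simp add: C_L2_def \<phi>_def[abs_def])
  ultimately have "continuous (at t within {0..}) \<phi>"
    by (simp add: continuous_within)
  then have "(\<phi> \<circ> g) \<longlonglongrightarrow> \<phi> t"
    unfolding continuous_within_sequentially using g by auto
  then show ?thesis
    using \<open>\<phi> t = 0\<close> by (simp add: \<phi>_def o_def)
qed

text \<open>Both times are approximated from \<open>G\<close>. Along good times the estimate itself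
  makes the values in the moving frame a Cauchy sequence and supplies a dominating function, so
  \<open>moving_frame_limit\<close> identifies the limit. Writing the bound as |\<Psi>(t) -
  \<Psi>(s)| makes it independent of the order of the times and continuous in them.\<close>

lemma variation_all_times:
  fixes u :: "real \<Rightarrow> real \<Rightarrow> complex" and q :: "real \<Rightarrow> real \<Rightarrow> real"
  defines "\<Psi> \<equiv> \<lambda>x t. integral {0..t} (q x)"
  assumes u: "C_L2 u" and u0: "u0 \<in> L2_space lebesgue" and "0 < T" and "0 \<le> K"
    and q_nonneg: "\<And>x t. 0 \<le> q x t"
    and q: "AE x in lborel. q x integrable_on {0..T} \<and> integral {0..T} (q x) \<le> B"
    and G: "AE t in lborel. t \<in> {0..T} \<longrightarrow> t \<in> G"
    and var: "\<And>s t. s \<in> G \<Longrightarrow> t \<in> G \<Longrightarrow> 0 \<le> s \<Longrightarrow> s \<le> t \<Longrightarrow> t \<le> T \<Longrightarrow>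
      AE x in lborel. cmod (u (x + \<sigma> * t) t - u (x + \<sigma> * s) s) \<le> K * cmod (u0 x) * integral {s..t} (q x)"
    and st: "s \<in> {0..T}" "t \<in> {0..T}"
  shows "AE x in lebesgue. cmod (u (x + \<sigma> * t) t - u (x + \<sigma> * s) s) \<le> K * cmod (u0 x) * \<bar>\<Psi> x t - \<Psi> x s\<bar>"
proof -
  have q': "AE x in lebesgue. q x integrable_on {0..T} \<and> integral {0..T} (q x) \<le> B"
    using q by (rule AE_completion)
  have \<Psi>_diff: "integral {s..t} (q x) = \<Psi> x t - \<Psi> x s"
    if "q x integrable_on {0..T}" "0 \<le> s" "s \<le> t" "t \<le> T" for x s t
  proof -
    have "q x integrable_on {0..t}"
      by (rule integrable_on_subinterval[OF that(1)]) (use that in auto)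
    from Henstock_Kurzweil_Integration.integral_combine[OF that(2,3) this] show ?thesis
      by (simp add: \<Psi>_def)
  qed
  have var_G: "AE x in lebesgue. cmod (u (x + \<sigma> * t) t - u (x + \<sigma> * s) s) \<le> K * cmod (u0 x) * \<bar>\<Psi> x t - \<Psi> x s\<bar>"
    if "s \<in> G \<inter> {0..T}" "t \<in> G \<inter> {0..T}" for s t
  proof (cases "s \<le> t")
    case True
    have "AE x in lebesgue. cmod (u (x + \<sigma> * t) t - u (x + \<sigma> * s) s) \<le> K * cmod (u0 x) * integral {s..t} (q x)"
      using that True by (intro AE_completion var) auto
    with q' show ?thesis
    proof eventually_elim
      case (elim x)
      then have "integral {s..t} (q x) = \<Psi> x t - \<Psi> x s"
        using that True by (intro \<Psi>_diff) auto
      also have "\<dots> \<le> \<bar>\<Psi> x t - \<Psi> x s\<bar>" by simp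
      finally show ?case
        using elim(2) \<open>0 \<le> K\<close> by (meson mult_left_mono mult_nonneg_nonneg norm_ge_zero order_trans)
    qed
  next
    case False
    have "AE x in lebesgue. cmod (u (x + \<sigma> * s) s - u (x + \<sigma> * t) t) \<le> K * cmod (u0 x) * integral {t..s} (q x)"
      using that False by (intro AE_completion var) auto
    with q' show ?thesis
    proof eventually_elim
      case (elim x)
      then have "integral {t..s} (q x) = \<Psi> x s - \<Psi> x t"
        using that False by (intro \<Psi>_diff) auto
      also have "\<dots> \<le> \<bar>\<Psi> x t - \<Psi> x s\<bar>" by simp
      finally show ?case
        using elim(2) \<open>0 \<le> K\<close> unfolding norm_minus_commute[of "u (x + \<sigma> * t) t"]
        by (meson mult_left_mono mult_nonneg_nonneg norm_ge_zero order_trans)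
    qed
  qed
  have \<Psi>_cont: "(\<lambda>k. \<Psi> x (g k)) \<longlonglongrightarrow> \<Psi> x t"
    if "q x integrable_on {0..T}" "\<And>k. g k \<in> {0..T}" "g \<longlonglongrightarrow> t" "t \<in> {0..T}" for x g t
  proof -
    have "continuous_on {0..T} (\<Psi> x)"
      unfolding \<Psi>_def by (intro indefinite_integral_continuous_1 that)
    from continuous_on_tendsto_compose[OF this that(3,4)] that(2) show ?thesis by simp
  qed
  have \<Psi>_bound: "\<bar>\<Psi> x t - \<Psi> x s\<bar> \<le> B"
    if "q x integrable_on {0..T}" "integral {0..T} (q x) \<le> B" "s \<in> {0..T}" "t \<in> {0..T}" for x s t
  proof -
    have "0 \<le> \<Psi> x r \<and> \<Psi> x r \<le> B" if r: "r \<in> {0..T}" for r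
    proof -
      have i: "q x integrable_on {0..r}"
        by (rule integrable_on_subinterval[OF \<open>q x integrable_on {0..T}\<close>]) (use r in auto)
      then have "\<Psi> x r \<le> integral {0..T} (q x)"
        unfolding \<Psi>_def using \<open>q x integrable_on {0..T}\<close> r q_nonneg by (intro integral_subset_le) auto
      with \<open>integral {0..T} (q x) \<le> B\<close> i q_nonneg show ?thesis
        by (auto simp: \<Psi>_def intro: Henstock_Kurzweil_Integration.integral_nonneg)
    qed
    from this[OF that(3)] this[OF that(4)] show ?thesis by (simp add: abs_le_iff)
  qed
  have approx: "\<exists>g. (\<forall>k. g k \<in> G \<inter> {0..T}) \<and> g \<longlonglongrightarrow> t \<and>
      (AE y in lebesgue. (\<lambda>k. u (y + \<sigma> * g k) (g k)) \<longlonglongrightarrow> u (y + \<sigma> * t) t)"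
    if t: "t \<in> {0..T}" for t
  proof -
    \<comment> \<open>\<open>G\<close> has full measure in [0,T] and so meets every nondegenerate
      interval; clipping at 0 and T makes this work for endpoints t as well.\<close>
    have "\<forall>k. \<exists>\<tau>. \<tau> \<in> G \<inter> {0..T} \<and> \<bar>\<tau> - t\<bar> \<le> inverse (real (Suc k))"
    proof
      fix k
      define e where "e = inverse (real (Suc k))"
      have "0 < e" by (simp add: e_def)
      have ae: "AE \<tau> in lborel. \<tau> \<in> {max 0 (t - e)..min T (t + e)} \<longrightarrow> \<tau> \<in> G"
        using G by eventually_elim auto
      have "max 0 (t - e) < min T (t + e)"
        using t \<open>0 < e\<close> \<open>0 < T\<close> by auto
      from AE_interval_ex[OF ae this] obtain \<tau>
        where "\<tau> \<in> {max 0 (t - e)..min T (t + e)}" "\<tau> \<in> G" by blast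
      then show "\<exists>\<tau>. \<tau> \<in> G \<inter> {0..T} \<and> \<bar>\<tau> - t\<bar> \<le> inverse (real (Suc k))"
        by (intro exI[of _ \<tau>]) (auto simp: abs_le_iff e_def)
    qed
    from choice[OF this] obtain g
      where g: "\<And>k. g k \<in> G \<inter> {0..T}" "\<And>k. \<bar>g k - t\<bar> \<le> inverse (real (Suc k))" by blast
    have lim: "g \<longlonglongrightarrow> t"
    proof (rule LIM_zero_cancel)
      show "(\<lambda>k. g k - t) \<longlonglongrightarrow> 0"
        by (rule Lim_null_comparison[OF _ LIMSEQ_inverse_real_of_nat]) (use g(2) in simp)
    qed
    have gT: "g k \<in> {0..T}" "0 \<le> g k" for k
      using g(1)[of k] by auto
    \<comment> \<open>Dominating function: the value at the first good time plus the largest change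
      that the estimate allows over [0,T].\<close>
    define m where "m y = cmod (u (y + \<sigma> * g 0) (g 0)) + K * cmod (u0 y) * B" for y
    have L2: "(\<lambda>x. u x r) \<in> L2_space lebesgue" if "0 \<le> r" for r
      using u that by (simp add: C_L2_def)
    have pairs: "AE y in lebesgue. \<forall>k l. cmod (u (y + \<sigma> * g k) (g k) - u (y + \<sigma> * g l) (g l))
        \<le> K * cmod (u0 y) * \<bar>\<Psi> y (g k) - \<Psi> y (g l)\<bar>"
      unfolding AE_all_countable by (intro allI var_G g)
    have "AE y in lebesgue. (\<lambda>k. u (y + \<sigma> * g k) (g k)) \<longlonglongrightarrow> u (y + \<sigma> * t) t"
    proof (rule moving_frame_limit)
      show "(\<lambda>k. L2_norm lebesgue (\<lambda>x. u x (g k) - u x t)) \<longlonglongrightarrow> 0"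
        using t gT by (intro C_L2_sequence u lim) auto
      show "set_integrable lebesgue {a..b} m" for a b
      proof -
        have "set_integrable lebesgue {a..b} (\<lambda>y. cmod (u (y + \<sigma> * g 0) (g 0)))"
          by (intro set_integrable_norm L2_space_set_integrable L2_space_translate[of "\<lambda>x. u x (g 0)"] L2 gT)
        moreover have "set_integrable lebesgue {a..b} (\<lambda>y. K * cmod (u0 y) * B)"
          by (intro set_integrable_mult_left set_integrable_mult_right set_integrable_norm L2_space_set_integrable u0)
        ultimately show ?thesis
          unfolding m_def[abs_def] by (rule set_integral_add)
      qed
      show "AE y in lebesgue. cmod (u (y + \<sigma> * g k) (g k)) \<le> m y" for k
        using pairs q'
      proof eventually_elim
        case (elim y)
        have "cmod (u (y + \<sigma> * g k) (g k)) \<le> cmod (u (y + \<sigma> * g 0) (g 0)) + cmod (u (y + \<sigma> * g k) (g k) - u (y + \<sigma> * g 0) (g 0))"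
          by (rule norm_triangle_sub)
        also have "cmod (u (y + \<sigma> * g k) (g k) - u (y + \<sigma> * g 0) (g 0)) \<le> K * cmod (u0 y) * \<bar>\<Psi> y (g k) - \<Psi> y (g 0)\<bar>"
          using elim by blast
        also have "\<dots> \<le> K * cmod (u0 y) * B"
          using elim \<open>0 \<le> K\<close> by (intro mult_left_mono \<Psi>_bound gT) auto
        finally show ?case by (simp add: m_def)
      qed
      show "AE y in lebesgue. convergent (\<lambda>k. u (y + \<sigma> * g k) (g k))"
        using pairs q'
      proof eventually_elim
        case (elim y)
        have "convergent (\<lambda>k. \<Psi> y (g k))"
          using \<Psi>_cont[of y g t] elim gT lim t by (intro convergentI) auto
        then show ?case
          by (rule convergent_if_variation_le[where c = "K * cmod (u0 y)"]) (use elim \<open>0 \<le> K\<close> in auto)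
      qed
    qed (use t gT L2 lim in auto)
    with g(1) lim show ?thesis by blast
  qed
  obtain g where g: "\<And>k. g k \<in> G \<inter> {0..T}" "g \<longlonglongrightarrow> s"
    "AE y in lebesgue. (\<lambda>k. u (y + \<sigma> * g k) (g k)) \<longlonglongrightarrow> u (y + \<sigma> * s) s"
    using approx[OF st(1)] by blast
  obtain h where h: "\<And>k. h k \<in> G \<inter> {0..T}" "h \<longlonglongrightarrow> t"
    "AE y in lebesgue. (\<lambda>k. u (y + \<sigma> * h k) (h k)) \<longlonglongrightarrow> u (y + \<sigma> * t) t"
    using approx[OF st(2)] by blast
  have "AE x in lebesgue. \<forall>k. cmod (u (x + \<sigma> * h k) (h k) - u (x + \<sigma> * g k) (g k))
      \<le> K * cmod (u0 x) * \<bar>\<Psi> x (h k) - \<Psi> x (g k)\<bar>"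
    unfolding AE_all_countable by (intro allI var_G g h)
  with q' g(3) h(3) show ?thesis
  proof eventually_elim
    case (elim x)
    have "(\<lambda>k. K * cmod (u0 x) * \<bar>\<Psi> x (h k) - \<Psi> x (g k)\<bar>) \<longlonglongrightarrow> K * cmod (u0 x) * \<bar>\<Psi> x t - \<Psi> x s\<bar>"
      using elim(1) g h st by (intro tendsto_intros \<Psi>_cont) auto
    moreover have "(\<lambda>k. cmod (u (x + \<sigma> * h k) (h k) - u (x + \<sigma> * g k) (g k))) \<longlonglongrightarrow> cmod (u (x + \<sigma> * t) t - u (x + \<sigma> * s) s)"
      by (intro tendsto_intros elim)
    ultimately show ?case
      using elim(4) by (intro tendsto_le[OF trivial_limit_sequentially]) auto
  qed
qed

section \<open>Asymptotic profiles\<close>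

text \<open>Each \<open>\<Psi> x\<close> is increasing and bounded by \<open>B\<close>, hence
  converges, and the estimate carries this over to u along the characteristic. The remainder is at
  most K * B * |u0|, which is square integrable and serves for dominated convergence.\<close>

lemma asymptotic_profile:
  fixes u :: "real \<Rightarrow> real \<Rightarrow> complex" and q :: "real \<Rightarrow> real \<Rightarrow> real"
  defines "\<Psi> \<equiv> \<lambda>x t. integral {0..t} (q x)"
  assumes u: "C_L2 u" and u0: "u0 \<in> L2_space lebesgue" and "0 \<le> K"
    and q_nonneg: "\<And>x t. 0 \<le> q x t"
    and q: "\<And>T. 0 < T \<Longrightarrow> AE x in lborel. q x integrable_on {0..T} \<and> integral {0..T} (q x) \<le> B"
    and var: "\<And>s t. 0 \<le> s \<Longrightarrow> 0 \<le> t \<Longrightarrow>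
      AE x in lebesgue. cmod (u (x + \<sigma> * t) t - u (x + \<sigma> * s) s) \<le> K * cmod (u0 x) * \<bar>\<Psi> x t - \<Psi> x s\<bar>"
  shows "\<exists>g\<in>L2_space lebesgue.
    ((\<lambda>t. LINT x|lebesgue. (cmod (u x t - u0 (x - \<sigma> * t) - g (x - \<sigma> * t)))\<^sup>2) \<longlongrightarrow> 0) at_top"
proof -
  define U where "U t y = u (y + \<sigma> * t) t" for t y
  have U_L2: "U t \<in> L2_space lebesgue" if "0 \<le> t" for t
    using u that L2_space_translate[of "\<lambda>x. u x t" "\<sigma> * t"] by (simp add: C_L2_def U_def[abs_def])
  have q': "AE x in lebesgue. \<forall>n. q x integrable_on {0..real (Suc n)} \<and> integral {0..real (Suc n)} (q x) \<le> B"
    unfolding AE_all_countable by (intro allI AE_completion q) simp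
  define \<psi> where "\<psi> x = lim (\<lambda>k. \<Psi> x (real k))" for x
  have \<Psi>: "((\<Psi> x \<longlongrightarrow> \<psi> x) at_top) \<and> (\<forall>t\<ge>0. \<bar>\<Psi> x t - \<psi> x\<bar> \<le> B)"
    if *: "\<forall>n. q x integrable_on {0..real (Suc n)} \<and> integral {0..real (Suc n)} (q x) \<le> B" for x
  proof -
    have int: "q x integrable_on {0..t}" for t
    proof -
      obtain n where "t \<le> real n" using real_arch_simple by blast
      then show ?thesis
        by (intro integrable_on_subinterval[OF *[rule_format, THEN conjunct1, of n]]) auto
    qed
    have mono: "\<Psi> x s \<le> \<Psi> x t" if "s \<le> t" for s t
      unfolding \<Psi>_def using that int q_nonneg by (intro integral_subset_le) auto
    have nonneg: "0 \<le> \<Psi> x t" for t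
      unfolding \<Psi>_def using int q_nonneg by (intro Henstock_Kurzweil_Integration.integral_nonneg) auto
    have le_B: "\<Psi> x t \<le> B" for t
    proof -
      obtain n where "t \<le> real n" using real_arch_simple by blast
      then have "\<Psi> x t \<le> \<Psi> x (real (Suc n))" by (intro mono) auto
      also have "\<dots> \<le> B" using * by (simp add: \<Psi>_def)
      finally show ?thesis .
    qed
    have "incseq (\<lambda>k. \<Psi> x (real k))"
      by (intro incseq_SucI mono) simp
    from incseq_convergent[OF this, of B] le_B obtain l where l: "(\<lambda>k. \<Psi> x (real k)) \<longlonglongrightarrow> l" "\<And>k. \<Psi> x (real k) \<le> l"
      by blast
    have \<psi>: "\<psi> x = l"
      using l(1) by (simp add: \<psi>_def limI)
    have le_l: "\<Psi> x t \<le> l" for t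
    proof -
      obtain n where "t \<le> real n" using real_arch_simple by blast
      with mono l(2)[of n] show ?thesis by (meson order_trans)
    qed
    have "l \<le> B"
      using l(1) le_B by (intro LIMSEQ_le_const2) auto
    have "(\<Psi> x \<longlongrightarrow> l) at_top"
    proof (rule order_tendstoI)
      fix a assume "a < l"
      from order_tendstoD(1)[OF l(1) this] obtain k where k: "a < \<Psi> x (real k)"
        by (auto simp: eventually_sequentially)
      then have "a < \<Psi> x t" if "real k \<le> t" for t
        using mono[OF that] by simp
      then show "\<forall>\<^sub>F t in at_top. a < \<Psi> x t"
        unfolding eventually_at_top_linorder by blast
    next
      fix a assume "l < a"
      then show "\<forall>\<^sub>F t in at_top. \<Psi> x t < a"
        using le_l by (auto intro!: always_eventually intro: le_less_trans)
    qed
    moreover have "\<bar>\<Psi> x t - l\<bar> \<le> B" for t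
      using le_l[of t] nonneg[of t] \<open>l \<le> B\<close> by linarith
    ultimately show ?thesis by (simp add: \<psi>)
  qed
  \<comment> \<open>The limit is taken along integer times: \<open>F\<close> is then measurable, and
    only countably many null sets are discarded. Other times are reached through
    \<open>tail\<close>, whose null set may depend on t.\<close>
  define F where "F y = lim (\<lambda>k. U (real k) y)" for y
  have F_meas: "F \<in> borel_measurable lebesgue"
    unfolding F_def[abs_def] using U_L2 by (intro borel_measurable_lim_metric) (auto simp: L2_space_def)
  have pairs: "AE y in lebesgue. \<forall>k l. cmod (U (real k) y - U (real l) y)
      \<le> K * cmod (u0 y) * \<bar>\<Psi> y (real k) - \<Psi> y (real l)\<bar>"
    unfolding AE_all_countable U_def by (intro allI var) auto
  have F_lim: "AE y in lebesgue. (\<lambda>k. U (real k) y) \<longlonglongrightarrow> F y"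
    using pairs q'
  proof eventually_elim
    case (elim y)
    have "(\<lambda>k. \<Psi> y (real k)) \<longlonglongrightarrow> \<psi> y"
      by (rule filterlim_compose[OF conjunct1[OF \<Psi>[OF elim(2)]] filterlim_real_sequentially])
    then have "convergent (\<lambda>k. \<Psi> y (real k))"
      by (rule convergentI)
    then have "convergent (\<lambda>k. U (real k) y)"
      by (rule convergent_if_variation_le[where c = "K * cmod (u0 y)"]) (use elim \<open>0 \<le> K\<close> in auto)
    then show ?case by (simp add: F_def convergent_LIMSEQ_iff)
  qed
  have tail: "AE y in lebesgue. cmod (U t y - F y) \<le> K * cmod (u0 y) * \<bar>\<Psi> y t - \<psi> y\<bar>" if "0 \<le> t" for t
  proof -
    have "AE y in lebesgue. \<forall>k. cmod (U t y - U (real k) y) \<le> K * cmod (u0 y) * \<bar>\<Psi> y t - \<Psi> y (real k)\<bar>"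
      unfolding AE_all_countable U_def using that by (intro allI var) auto
    with F_lim q' show ?thesis
    proof eventually_elim
      case (elim y)
      have "(\<lambda>k. \<Psi> y (real k)) \<longlonglongrightarrow> \<psi> y"
        by (rule filterlim_compose[OF conjunct1[OF \<Psi>[OF elim(2)]] filterlim_real_sequentially])
      then have "(\<lambda>k. K * cmod (u0 y) * \<bar>\<Psi> y t - \<Psi> y (real k)\<bar>) \<longlonglongrightarrow> K * cmod (u0 y) * \<bar>\<Psi> y t - \<psi> y\<bar>"
        by (intro tendsto_intros)
      moreover have "(\<lambda>k. cmod (U t y - U (real k) y)) \<longlonglongrightarrow> cmod (U t y - F y)"
        by (intro tendsto_intros elim)
      ultimately show ?case
        using elim(3) by (intro tendsto_le[OF trivial_limit_sequentially]) auto
    qed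
  qed
  have tail_B: "AE y in lebesgue. (cmod (U t y - F y))\<^sup>2 \<le> (K * B)\<^sup>2 * (cmod (u0 y))\<^sup>2" if "0 \<le> t" for t
    using tail[OF that] q'
  proof eventually_elim
    case (elim y)
    have "cmod (U t y - F y) \<le> K * cmod (u0 y) * B"
      using elim(1) \<Psi>[OF elim(2)] that \<open>0 \<le> K\<close>
      by (meson mult_left_mono mult_nonneg_nonneg norm_ge_zero order_trans)
    then have "(cmod (U t y - F y))\<^sup>2 \<le> (K * cmod (u0 y) * B)\<^sup>2"
      by (intro power_mono) auto
    then show ?case by (simp add: power_mult_distrib mult_ac)
  qed
  have dom_int: "integrable lebesgue (\<lambda>y. (K * B)\<^sup>2 * (cmod (u0 y))\<^sup>2)"
    using u0 by (simp add: L2_space_def)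
  have diff_meas: "(\<lambda>y. (cmod (U t y - F y))\<^sup>2) \<in> borel_measurable lebesgue" if "0 \<le> t" for t
    using U_L2[OF that] F_meas by (auto simp: L2_space_def)
  \<comment> \<open>\<open>F\<close> is square integrable as the difference of \<open>U 0\<close>
    and the dominated remainder at time 0.\<close>
  have "(\<lambda>y. U 0 y - F y) \<in> L2_space lebesgue"
  proof -
    have "integrable lebesgue (\<lambda>y. (cmod (U 0 y - F y))\<^sup>2)"
      by (rule Bochner_Integration.integrable_bound[OF dom_int diff_meas])
        (use tail_B[of 0] in \<open>auto elim!: eventually_mono\<close>)
    then show ?thesis
      using U_L2[of 0] F_meas by (auto simp: L2_space_def)
  qed
  from L2_space_diff[OF U_L2[of 0] this] have F_L2: "F \<in> L2_space lebesgue"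
    by simp
  have int_lim: "((\<lambda>t. LINT y|lebesgue. (cmod (U t y - F y))\<^sup>2) \<longlongrightarrow> 0) at_top"
  \<comment> \<open>Along a sequence of times the exceptional null sets are again countable.
    Negative times, where nothing is known, are cut off by \<open>max 0\<close>, which eventually
    changes nothing.\<close>
  proof (rule tendsto_at_topI_sequentially)
    fix X :: "nat \<Rightarrow> real" assume X: "filterlim X at_top sequentially"
    have X0: "\<forall>\<^sub>F n in sequentially. max 0 (X n) = X n"
      using X unfolding filterlim_at_top by (auto elim!: allE[of _ 0] eventually_mono)
    have X': "filterlim (\<lambda>n. max 0 (X n)) at_top sequentially"
      by (rule filterlim_at_top_mono[OF X]) simp
    have "(\<lambda>n. LINT y|lebesgue. (cmod (U (max 0 (X n)) y - F y))\<^sup>2) \<longlonglongrightarrow> (LINT y|(lebesgue :: real measure). (0::real))"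
    proof (rule integral_dominated_convergence[OF _ _ dom_int])
      have "AE y in lebesgue. \<forall>n. cmod (U (max 0 (X n)) y - F y) \<le> K * cmod (u0 y) * \<bar>\<Psi> y (max 0 (X n)) - \<psi> y\<bar>"
        unfolding AE_all_countable by (intro allI tail) simp
      then show "AE y in lebesgue. (\<lambda>n. (cmod (U (max 0 (X n)) y - F y))\<^sup>2) \<longlonglongrightarrow> 0"
        using q'
      proof eventually_elim
        case (elim y)
        have "(\<lambda>n. \<Psi> y (max 0 (X n))) \<longlonglongrightarrow> \<psi> y"
          by (rule filterlim_compose[OF conjunct1[OF \<Psi>[OF elim(2)]] X'])
        then have "(\<lambda>n. K * cmod (u0 y) * \<bar>\<Psi> y (max 0 (X n)) - \<psi> y\<bar>) \<longlonglongrightarrow> K * cmod (u0 y) * \<bar>\<psi> y - \<psi> y\<bar>"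
          by (intro tendsto_intros)
        then have "(\<lambda>n. cmod (U (max 0 (X n)) y - F y)) \<longlonglongrightarrow> 0"
          using elim(1) by (intro Lim_null_comparison[of "\<lambda>n. cmod (U (max 0 (X n)) y - F y)"]) auto
        then have "(\<lambda>n. (cmod (U (max 0 (X n)) y - F y))\<^sup>2) \<longlonglongrightarrow> 0\<^sup>2"
          by (rule tendsto_power)
        then show ?case by simp
      qed
      show "AE y in lebesgue. norm ((cmod (U (max 0 (X n)) y - F y))\<^sup>2) \<le> (K * B)\<^sup>2 * (cmod (u0 y))\<^sup>2" for n
        using tail_B[of "max 0 (X n)"] by simp
    qed (use diff_meas in auto)
    moreover have "\<forall>\<^sub>F n in sequentially. (LINT y|lebesgue. (cmod (U (max 0 (X n)) y - F y))\<^sup>2) = (LINT y|lebesgue. (cmod (U (X n) y - F y))\<^sup>2)"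
      using X0 by eventually_elim simp
    ultimately show "(\<lambda>n. LINT y|lebesgue. (cmod (U (X n) y - F y))\<^sup>2) \<longlonglongrightarrow> 0"
      by (simp add: tendsto_cong)
  qed
  show ?thesis
  proof (intro bexI)
    \<comment> \<open>The profile is the total change of u along the characteristic, so
      \<open>u0\<close> cancels in the integrand and only u - \<open>F\<close> remains.\<close>
    show "(\<lambda>y. F y - u0 y) \<in> L2_space lebesgue"
      by (rule L2_space_diff[OF F_L2 u0])
    have "(LINT x|lebesgue. (cmod (u x t - u0 (x - \<sigma> * t) - (F (x - \<sigma> * t) - u0 (x - \<sigma> * t))))\<^sup>2)
        = (LINT y|lebesgue. (cmod (U t y - F y))\<^sup>2)" for t
      using lebesgue_integral_real_affine[of 1 "\<lambda>x. (cmod (u x t - F (x - \<sigma> * t)))\<^sup>2" "\<sigma> * t"]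
      by (simp add: U_def add.commute)
    with int_lim show "((\<lambda>t. LINT x|lebesgue. (cmod (u x t - u0 (x - \<sigma> * t) - (F (x - \<sigma> * t) - u0 (x - \<sigma> * t))))\<^sup>2) \<longlongrightarrow> 0) at_top"
      by simp
  qed
qed

section \<open>Componentwise convergence of the approximants and uniform bounds on their initial
  mass\<close>

lemma L2_converges_pairD:
  assumes "L2_converges_pair M f' f g' g"
  shows "\<forall>\<^sub>F n in sequentially. (\<lambda>z. f' n z - f z) \<in> L2_space M"
    and "(\<lambda>n. L2_norm M (\<lambda>z. f' n z - f z)) \<longlonglongrightarrow> 0"
    and "\<forall>\<^sub>F n in sequentially. (\<lambda>z. g' n z - g z) \<in> L2_space M"
    and "(\<lambda>n. L2_norm M (\<lambda>z. g' n z - g z)) \<longlonglongrightarrow> 0"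
proof -
  have lim: "(\<lambda>n. L2_norm M (\<lambda>z. f' n z - f z) + L2_norm M (\<lambda>z. g' n z - g z)) \<longlonglongrightarrow> 0"
    using assms by (simp add: L2_converges_pair_def)
  have nonneg: "0 \<le> L2_norm M h" for h
    by (simp add: L2_norm_def)
  show "(\<lambda>n. L2_norm M (\<lambda>z. f' n z - f z)) \<longlonglongrightarrow> 0"
    by (rule tendsto_sandwich[OF _ _ tendsto_const lim]) (simp_all add: nonneg)
  show "(\<lambda>n. L2_norm M (\<lambda>z. g' n z - g z)) \<longlonglongrightarrow> 0"
    by (rule tendsto_sandwich[OF _ _ tendsto_const lim]) (simp_all add: nonneg)
  show "\<forall>\<^sub>F n in sequentially. (\<lambda>z. f' n z - f z) \<in> L2_space M"
    "\<forall>\<^sub>F n in sequentially. (\<lambda>z. g' n z - g z) \<in> L2_space M"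
    using assms by (auto simp: L2_converges_pair_def elim: eventually_mono)
qed

lemma L2_converges_pair_swap:
  "L2_converges_pair M f' f g' g \<Longrightarrow> L2_converges_pair M g' g f' f"
  by (simp add: L2_converges_pair_def add.commute conj_commute)

lemma L2_converges_pair_shift:
  "L2_converges_pair M f' f g' g \<Longrightarrow>
    L2_converges_pair M (\<lambda>n. f' (n + N)) f (\<lambda>n. g' (n + N)) g"
  unfolding L2_converges_pair_def
  by (intro conjI LIMSEQ_ignore_initial_segment[of "\<lambda>n. L2_norm M (\<lambda>z. f' n z - f z) + L2_norm M (\<lambda>z. g' n z - g z)"]
      eventually_sequentially_seg[of "\<lambda>n. (\<lambda>z. f' n z - f z) \<in> L2_space M \<and> (\<lambda>z. g' n z - g z) \<in> L2_space M", THEN iffD2])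
    blast+

lemma L2_converges_eventually_bounded:
  assumes f: "f \<in> L2_space M"
    and L2: "\<forall>\<^sub>F n in sequentially. (\<lambda>z. f' n z - f z) \<in> L2_space M"
    and lim: "(\<lambda>n. L2_norm M (\<lambda>z. f' n z - f z)) \<longlonglongrightarrow> 0"
  shows "\<forall>\<^sub>F n in sequentially. f' n \<in> L2_space M \<and>
    (LINT z|M. (cmod (f' n z))\<^sup>2) \<le> 2 + 2 * (LINT z|M. (cmod (f z))\<^sup>2)"
proof -
  have "\<forall>\<^sub>F n in sequentially. L2_norm M (\<lambda>z. f' n z - f z) < 1"
    using lim by (rule order_tendstoD) simp
  with L2 show ?thesis
  proof eventually_elim
    case (elim n)
    have neg: "(\<lambda>z. f z - f' n z) \<in> L2_space M"
      using L2_space_diff[of "\<lambda>_. 0", OF _ elim(1)] by (simp add: L2_space_def)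
    have f'n: "f' n \<in> L2_space M"
      using L2_space_diff[OF f neg] by simp
    have d: "(LINT z|M. (cmod (f' n z - f z))\<^sup>2) \<le> 1"
      using elim(2) by (auto simp: L2_norm_def dest: order.strict_implies_order)
    have "(LINT z|M. (cmod (f' n z))\<^sup>2) \<le> (LINT z|M. 2 * (cmod (f' n z - f z))\<^sup>2 + 2 * (cmod (f z))\<^sup>2)"
    proof (rule integral_mono)
      show "(cmod (f' n z))\<^sup>2 \<le> 2 * (cmod (f' n z - f z))\<^sup>2 + 2 * (cmod (f z))\<^sup>2" for z
        using cmod_diff_square_le[of "f' n z - f z" "- f z"] by simp
    qed (use f f'n elim(1) in \<open>auto simp: L2_space_def\<close>)
    also have "\<dots> = 2 * (LINT z|M. (cmod (f' n z - f z))\<^sup>2) + 2 * (LINT z|M. (cmod (f z))\<^sup>2)"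
      using f elim(1) by (simp add: L2_space_def)
    finally show ?case
      using d f'n by simp
  qed
qed

text \<open>The slope \<sigma> and the abstract hypotheses let one statement treat both components:
  \<sigma> = 1 for u driven by v, and \<sigma> = -1 with the roles exchanged.\<close>

lemma scattering_along_characteristics:
  fixes u v :: "real \<Rightarrow> real \<Rightarrow> complex" and un vn :: "nat \<Rightarrow> real \<Rightarrow> real \<Rightarrow> complex"
  assumes u: "C_L2 u" and u0: "u0 \<in> L2_space lebesgue"
    and cont_u: "\<And>n. continuous_on (UNIV \<times> {0..}) (\<lambda>(x, t). un n x t)"
    and cont_v: "\<And>n. continuous_on (UNIV \<times> {0..}) (\<lambda>(x, t). vn n x t)"
    and variation: "\<And>n x s t. 0 \<le> s \<Longrightarrow> s \<le> t \<Longrightarrow>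
      cmod (un n (x + \<sigma> * t) t - un n (x + \<sigma> * s) s)
        \<le> L * cmod (un n x 0) * integral {s..t} (\<lambda>\<tau>. (cmod (vn n (x + \<sigma> * \<tau>) \<tau>))\<^sup>2)"
    and bound: "\<And>n x t. 0 \<le> t \<Longrightarrow> integral {0..t} (\<lambda>\<tau>. (cmod (vn n (x + \<sigma> * \<tau>) \<tau>))\<^sup>2) \<le> B"
    and "0 \<le> L"
    and lim: "\<And>T. 0 < T \<Longrightarrow> L2_converges_pair (lebesgue_on (UNIV \<times> {0..T}))
      (\<lambda>n (x, t). un n x t) (\<lambda>(x, t). u x t) (\<lambda>n (x, t). vn n x t) (\<lambda>(x, t). v x t)"
    and lim0: "L2_converges_pair lebesgue (\<lambda>n x. un n x 0) u0 (\<lambda>n x. vn n x 0) v0"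
  shows "\<exists>g\<in>L2_space lebesgue.
    ((\<lambda>t. LINT x|lebesgue. (cmod (u x t - u0 (x - \<sigma> * t) - g (x - \<sigma> * t)))\<^sup>2) \<longlongrightarrow> 0) at_top"
proof -
  have "(\<lambda>(x, t). v x t) \<in> borel_measurable (lebesgue_on (UNIV \<times> {0..T}))" if T: "0 < T" for T
  proof -
    obtain n where "(\<lambda>z. (case z of (x, t) \<Rightarrow> vn n x t) - (case z of (x, t) \<Rightarrow> v x t))
        \<in> L2_space (lebesgue_on (UNIV \<times> {0..T}))"
      using eventually_happens[OF L2_converges_pairD(3)[OF lim[OF T]]] by auto
    then have 1: "(\<lambda>z. (case z of (x, t) \<Rightarrow> vn n x t) - (case z of (x, t) \<Rightarrow> v x t))
        \<in> borel_measurable (lebesgue_on (UNIV \<times> {0..T}))"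
      by (simp add: L2_space_def)
    have 2: "(\<lambda>(x, t). vn n x t) \<in> borel_measurable (lebesgue_on (UNIV \<times> {0..T}))"
    proof (rule continuous_imp_measurable_on_sets_lebesgue)
      show "continuous_on (UNIV \<times> {0..T}) (\<lambda>(x, t). vn n x t)"
        by (rule continuous_on_subset[OF cont_v]) auto
      show "UNIV \<times> {0..T} \<in> sets lebesgue"
        by (intro sets_completionI_sets) (auto intro!: borel_closed closed_Times)
    qed
    show ?thesis
      \<comment> \<open>\<open>v\<close> is recovered as the continuous approximant minus the
        measurable difference.\<close>
      using borel_measurable_diff[OF 2 1] by (simp add: split_def)
  qed
  from halfplane_borel_representative[OF this] obtain w where w: "w \<in> borel_measurable borel"
    "AE z in lborel. 0 \<le> snd z \<longrightarrow> w z = v (fst z) (snd z)" by blast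
  define q where "q x \<tau> = (cmod (w (x + \<sigma> * \<tau>, \<tau>)))\<^sup>2" for x \<tau>
  have q_nonneg: "0 \<le> q x \<tau>" for x \<tau>
    by (simp add: q_def)
  note limit = characteristic_variation_limit[where un = un and vn = vn and u = u and v = v
      and w = w and \<sigma> = \<sigma> and L = L and B = B, OF cont_u cont_v variation bound \<open>0 \<le> L\<close> _ w
      L2_converges_pairD[OF lim] L2_converges_pairD(1,2)[OF lim0], folded q_def]
  have q: "AE x in lborel. q x integrable_on {0..T} \<and> integral {0..T} (q x) \<le> 2 * B" if "0 < T" for T
    using limit(1)[of T] that by simp
  show ?thesis
  proof (rule asymptotic_profile[where q = q and K = "2 * L" and B = "2 * B", OF u u0])
    fix s t :: real assume st: "0 \<le> s" "0 \<le> t"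
    \<comment> \<open>Any horizon beyond both times would do; the 1 keeps it positive when s = t =
      0.\<close>
    define T where "T = s + t + 1"
    have T: "0 < T" "s \<in> {0..T}" "t \<in> {0..T}"
      using st by (auto simp: T_def)
    obtain G where "AE t in lborel. t \<in> {0..T} \<longrightarrow> t \<in> G"
      "\<And>s t. s \<in> G \<Longrightarrow> t \<in> G \<Longrightarrow> 0 \<le> s \<Longrightarrow> s \<le> t \<Longrightarrow> t \<le> T \<Longrightarrow>
        AE x in lborel. cmod (u (x + \<sigma> * t) t - u (x + \<sigma> * s) s) \<le> 2 * L * cmod (u0 x) * integral {s..t} (q x)"
      using limit(2)[of T] T(1) by blast
    from variation_all_times[OF u u0 T(1) _ q_nonneg q[OF T(1)] this T(2,3)]
    show "AE x in lebesgue. cmod (u (x + \<sigma> * t) t - u (x + \<sigma> * s) s)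
        \<le> 2 * L * cmod (u0 x) * \<bar>integral {0..t} (q x) - integral {0..s} (q x)\<bar>"
      using \<open>0 \<le> L\<close> by simp
  qed (use q q_nonneg \<open>0 \<le> L\<close> in auto)
qed

theorem theorem1p2:
  fixes \<alpha> \<beta> :: real
    and u0 v0 :: "real \<Rightarrow> complex"
    and u v :: "real \<Rightarrow> real \<Rightarrow> complex"
  assumes "u0 \<in> L2_space lebesgue" and "v0 \<in> L2_space lebesgue"
    and "strong_solution \<alpha> \<beta> u0 v0 u v"
  shows "\<exists>g1 g2. g1 \<in> L2_space lebesgue \<and> g2 \<in> L2_space lebesgue \<and>
    ((\<lambda>t. LINT x|lebesgue. (cmod (u x t - u0 (x - t) - g1 (x - t)))\<^sup>2) \<longlongrightarrow> 0) at_top \<and>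
    ((\<lambda>t. LINT x|lebesgue. (cmod (v x t - v0 (x + t) - g2 (x + t)))\<^sup>2) \<longlongrightarrow> 0) at_top"
proof -
  obtain un vn where C: "C_L2 u" "C_L2 v"
    and sol: "\<And>n. classical_solution \<alpha> \<beta> (un n) (vn n)"
    and lim: "\<And>T. 0 < T \<Longrightarrow> L2_converges_pair (lebesgue_on (UNIV \<times> {0..T}))
      (\<lambda>n (x, t). un n x t) (\<lambda>(x, t). u x t) (\<lambda>n (x, t). vn n x t) (\<lambda>(x, t). v x t)"
    and lim0: "L2_converges_pair lebesgue (\<lambda>n x. un n x 0) u0 (\<lambda>n x. vn n x 0) v0"
    using assms(3) unfolding strong_solution_def by blast
  \<comment> \<open>Half of the sum of the two bounds 2 + 2 * (squared norm of the data) from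
    \<open>L2_converges_eventually_bounded\<close>, so the initial mass of the approximants is
    eventually at most 2 * B.\<close>
  define B where "B = 2 + (LINT x|lebesgue. (cmod (u0 x))\<^sup>2) + (LINT x|lebesgue. (cmod (v0 x))\<^sup>2)"
  define c where "c = \<bar>\<alpha>\<bar> + 4 * \<bar>\<beta>\<bar>"
  have "0 \<le> c * exp (c * B)" by (simp add: c_def)
  have "\<forall>\<^sub>F n in sequentially.
      ((\<lambda>x. un n x 0) \<in> L2_space lebesgue \<and> (LINT x|lebesgue. (cmod (un n x 0))\<^sup>2) \<le> 2 + 2 * (LINT x|lebesgue. (cmod (u0 x))\<^sup>2)) \<and>
      ((\<lambda>x. vn n x 0) \<in> L2_space lebesgue \<and> (LINT x|lebesgue. (cmod (vn n x 0))\<^sup>2) \<le> 2 + 2 * (LINT x|lebesgue. (cmod (v0 x))\<^sup>2))"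
    using L2_converges_eventually_bounded[OF assms(1) L2_converges_pairD(1,2)[OF lim0]]
      L2_converges_eventually_bounded[OF assms(2) L2_converges_pairD(3,4)[OF lim0]]
    by (rule eventually_conj)
  then have "\<forall>\<^sub>F n in sequentially. (\<lambda>x. un n x 0) \<in> L2_space lebesgue \<and> (\<lambda>x. vn n x 0) \<in> L2_space lebesgue \<and>
      (LINT x|lebesgue. (cmod (un n x 0))\<^sup>2) + (LINT x|lebesgue. (cmod (vn n x 0))\<^sup>2) \<le> 2 * B"
    by (rule eventually_mono) (auto simp: B_def)
  then obtain N where N: "\<And>n. n \<ge> N \<Longrightarrow> (\<lambda>x. un n x 0) \<in> L2_space lebesgue \<and> (\<lambda>x. vn n x 0) \<in> L2_space lebesgue \<and>
      (LINT x|lebesgue. (cmod (un n x 0))\<^sup>2) + (LINT x|lebesgue. (cmod (vn n x 0))\<^sup>2) \<le> 2 * B"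
    unfolding eventually_sequentially by blast
  \<comment> \<open>Dropping the first \<open>N\<close> approximants makes the mass bound, and with
    it the constant \<open>L\<close>, valid for every index.\<close>
  define un' where "un' n = un (n + N)" for n
  define vn' where "vn' n = vn (n + N)" for n
  have sol': "classical_solution \<alpha> \<beta> (un' n) (vn' n)" for n
    by (simp add: un'_def vn'_def sol)
  have data: "integrable lebesgue (\<lambda>x. (cmod (un' n x 0))\<^sup>2)" "integrable lebesgue (\<lambda>x. (cmod (vn' n x 0))\<^sup>2)"
    "(LINT x|lebesgue. (cmod (un' n x 0))\<^sup>2) + (LINT x|lebesgue. (cmod (vn' n x 0))\<^sup>2) \<le> 2 * B" for n
    using N[of "n + N"] by (auto simp: un'_def vn'_def L2_space_def)
  have cont: "continuous_on (UNIV \<times> {0..}) (\<lambda>(x, t). un' n x t)"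
    "continuous_on (UNIV \<times> {0..}) (\<lambda>(x, t). vn' n x t)" for n
    using sol'[of n] by (auto simp: classical_solution_def C1_halfplane_def)
  have lim': "L2_converges_pair (lebesgue_on (UNIV \<times> {0..T}))
      (\<lambda>n (x, t). un' n x t) (\<lambda>(x, t). u x t) (\<lambda>n (x, t). vn' n x t) (\<lambda>(x, t). v x t)" if "0 < T" for T
    using L2_converges_pair_shift[OF lim[OF that], of N] by (simp add: un'_def vn'_def)
  have lim0': "L2_converges_pair lebesgue (\<lambda>n x. un' n x 0) u0 (\<lambda>n x. vn' n x 0) v0"
    using L2_converges_pair_shift[OF lim0, of N] by (simp add: un'_def vn'_def)
  have "\<exists>g\<in>L2_space lebesgue.
      ((\<lambda>t. LINT x|lebesgue. (cmod (u x t - u0 (x - 1 * t) - g (x - 1 * t)))\<^sup>2) \<longlongrightarrow> 0) at_top"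
    using classical_solution_right_characteristics[OF sol' data] C(1) assms(1) cont \<open>0 \<le> c * exp (c * B)\<close> lim' lim0'
    by (intro scattering_along_characteristics[where un = un' and vn = vn' and L = "c * exp (c * B)" and B = B])
      (simp_all add: c_def)
  moreover have "\<exists>g\<in>L2_space lebesgue.
      ((\<lambda>t. LINT x|lebesgue. (cmod (v x t - v0 (x - (- 1) * t) - g (x - (- 1) * t)))\<^sup>2) \<longlongrightarrow> 0) at_top"
    using classical_solution_left_characteristics[OF sol' data] C(2) assms(2) cont \<open>0 \<le> c * exp (c * B)\<close>
      lim'[THEN L2_converges_pair_swap] lim0'[THEN L2_converges_pair_swap]
    by (intro scattering_along_characteristics[where un = vn' and vn = un' and L = "c * exp (c * B)" and B = B])
      (simp_all add: c_def)
  ultimately show ?thesis by auto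
qed

end
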